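(* Let $q$ be an odd prime power, $m>1$ an odd integer, $N=\frac{q^m-1}{q-1}$, $\omega$ a primitive element of $\mathbb{F}_{q^m}$, and $k=\frac{m-1}{2}$. Let $A,A_0,A_1$, $H_\ell,H_{\ell,0},H_{\ell,1}$, the elements $a_1,\dots,a_k,b$, and the set $D$ be as defined in the context below. Let $I=\{i\in\mathbb{Z}_N:\mathrm{Tr}_{q^m/q}(\omega^i)=0\}$ and $2^{-1}I=\{u\in\mathbb{Z}_N:2u\in I\}$. Then for every integer $c$, $$2\,\psi(\omega^c D)-\psi\Big(\omega^c\bigcup_{t\in\mathbb{Z}_N\setminus 2^{-1}I}C_t^{(N,q^m)}\Big)=\begin{cases}0,&\text{if } c\bmod N\in 2^{-1}I,\\ \pm G_{q^m}(\eta),&\text{otherwise,}\end{cases}$$ where $\pm G_{q^m}(\eta)$ means the value is either $G_{q^m}(\eta)$ or $-G_{q^m}(\eta)$.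
   Context: $C_t^{(N,q^m)}=\omega^t\langle\omega^N\rangle=\omega^t\mathbb{F}_q^\ast$. $\psi$ is the canonical additive character $\psi(x)=e^{2\pi i\,\mathrm{Tr}_{q^m/p}(x)/p}$ of $\mathbb{F}_{q^m}$ ($p$ the characteristic), $\psi(S)=\sum_{x\in S}\psi(x)$, $\eta$ is the quadratic character of $\mathbb{F}_{q^m}$ and $G_{q^m}(\eta)=\sum_{x\ne0}\eta(x)\psi(x)$. $C_0^{(2,q)}$ and $C_1^{(2,q)}$ denote the nonzero squares and the nonsquares of $\mathbb{F}_q$. Define $A=\{x\in\mathbb{F}_{q^m}^\ast:\mathrm{Tr}_{q^m/q}(x^2)=0\}$ and $A_j=\{x\in\mathbb{F}_{q^m}^\ast:\mathrm{Tr}_{q^m/q}(x^2)\in C_j^{(2,q)}\}$ ($j=0,1$). Choose $a_1\in A$ and, for $2\le\ell\le k$, $a_\ell\in A\cap H_1\cap\dots\cap H_{\ell-1}$, such that $a_1,\dots,a_k$ are linearly independent over $\mathbb{F}_q$, where for $1\le\ell\le k$: $H_\ell=\{x\in\mathbb{F}_{q^m}^\ast:\mathrm{Tr}_{q^m/q}(xa_\ell)=0\}$ and $H_{\ell,j}=\{x\in\mathbb{F}_{q^m}^\ast:\mathrm{Tr}_{q^m/q}(xa_\ell)\in C_j^{(2,q)}\}$ (such choices exist). Fix $b\in(H_1\cap\dots\cap H_k)\setminus A$. Let $T_1=(A_0\cap H_{1,0})\cup(A_1\cap H_{1,1})$, and for $2\le\ell\le k$, $T_\ell=(A_0\cap H_1\cap\dots\cap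 H_{\ell-1}\cap H_{\ell,0})\cup(A_1\cap H_1\cap\dots\cap H_{\ell-1}\cap H_{\ell,1})$. Let $B=\{a_1x_1+\dots+a_kx_k+by: x_1,\dots,x_k\in\mathbb{F}_q,\ y\in C_0^{(2,q)}\}$ and $D=\big(\bigcup_{\ell=1}^{k}T_\ell\big)\cup B$. (The set $D$ is a union of cosets $C_t^{(2N,q^m)}=\omega^t\langle\omega^{2N}\rangle$, and $D\cup\omega^ND=\mathbb{F}_{q^m}^\ast\setminus A$ disjointly.) *)

theory Defs
  imports "HOL-Analysis.Analysis"
begin

definition rtr :: "nat \<Rightarrow> nat \<Rightarrow> 'a::field \<Rightarrow> 'a" where
  "rtr q m x = (\<Sum>i<m. x ^ (q ^ i))"

definition Fq :: "nat \<Rightarrow> 'a::field set" where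
  "Fq q = {x. x ^ q = x}"

definition Csq :: "nat \<Rightarrow> nat \<Rightarrow> 'a::field set" where
  "Csq q j = (if j = 0 then {y ^ 2 | y. y \<in> Fq q \<and> y \<noteq> 0}
              else (Fq q - {0}) - {y ^ 2 | y. y \<in> Fq q \<and> y \<noteq> 0})"

definition abs_tr :: "'a::{field,finite} \<Rightarrow> 'a" where
  "abs_tr x = (\<Sum>i < (THE d. CHAR('a) ^ d = CARD('a)). x ^ (CHAR('a) ^ i))"

definition psi :: "'a::{field,finite} \<Rightarrow> complex" where
  "psi x = cis (2 * pi * real (THE n. n < CHAR('a) \<and> of_nat n = abs_tr x) / real CHAR('a))"

definition psi_set :: "'a::{field,finite} set \<Rightarrow> complex" where
  "psi_set S = (\<Sum>x\<in>S. psi x)"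

definition eta :: "'a::{field,finite} \<Rightarrow> complex" where
  "eta x = (if x = 0 then 0 else if (\<exists>y. x = y ^ 2) then 1 else -1)"

definition gauss_eta :: "'a::{field,finite} itself \<Rightarrow> complex" where
  "gauss_eta _ = (\<Sum>x\<in>(UNIV::'a set) - {0}. eta x * psi x)"

definition Aset :: "nat \<Rightarrow> nat \<Rightarrow> 'a::field set" where
  "Aset q m = {x. x \<noteq> 0 \<and> rtr q m (x ^ 2) = 0}"

definition Ajset :: "nat \<Rightarrow> nat \<Rightarrow> nat \<Rightarrow> 'a::field set" where
  "Ajset q m j = {x. x \<noteq> 0 \<and> rtr q m (x ^ 2) \<in> Csq q j}"

definition Hset :: "nat \<Rightarrow> nat \<Rightarrow> 'a::field \<Rightarrow> 'a set" where
  "Hset q m a = {x. x \<noteq> 0 \<and> rtr q m (x * a) = 0}"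

definition Hjset :: "nat \<Rightarrow> nat \<Rightarrow> 'a::field \<Rightarrow> nat \<Rightarrow> 'a set" where
  "Hjset q m a j = {x. x \<noteq> 0 \<and> rtr q m (x * a) \<in> Csq q j}"

text \<open>T_l; for l = 1 the empty intersection over {1..<1} is UNIV, giving T_1.\<close>
definition Tset :: "nat \<Rightarrow> nat \<Rightarrow> (nat \<Rightarrow> 'a::field) \<Rightarrow> nat \<Rightarrow> 'a set" where
  "Tset q m a l =
     (Ajset q m 0 \<inter> (\<Inter>j\<in>{1..<l}. Hset q m (a j)) \<inter> Hjset q m (a l) 0) \<union>
     (Ajset q m 1 \<inter> (\<Inter>j\<in>{1..<l}. Hset q m (a j)) \<inter> Hjset q m (a l) 1)"

definition Bset :: "nat \<Rightarrow> nat \<Rightarrow> (nat \<Rightarrow> 'a::field) \<Rightarrow> 'a \<Rightarrow> 'a set" where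
  "Bset q k a b = {(\<Sum>i\<in>{1..k}. a i * x i) + b * y | x y.
                    (\<forall>i\<in>{1..k}. x i \<in> Fq q) \<and> y \<in> Csq q 0}"

definition Dset :: "nat \<Rightarrow> nat \<Rightarrow> nat \<Rightarrow> (nat \<Rightarrow> 'a::field) \<Rightarrow> 'a \<Rightarrow> 'a set" where
  "Dset q m k a b = (\<Union>l\<in>{1..k}. Tset q m a l) \<union> Bset q k a b"

definition cyc :: "'a::field \<Rightarrow> nat \<Rightarrow> nat \<Rightarrow> 'a set" where
  "cyc \<omega> N t = {\<omega> ^ t * \<omega> ^ (N * j) | j. True}"

end

theory Submission
  imports Defs "HOL-Number_Theory.Cong" "HOL-Computational_Algebra.Polynomial"
begin

text \<open>Write \<open>T\<close> for the relative trace, \<open>\<chi>\<close> for the quadratic character of \<open>K = GF(q)\<close>,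
  \<open>g\<close> for its Gauss sum and \<open>W\<close> for the totally isotropic span of the \<open>a\<^sub>l\<close>.
  The left-hand side is the Fourier transform at \<open>\<gamma> = \<omega>\<^sup>c\<close> of a function which equals
  \<open>\<chi>(T(x\<^sup>2)) \<chi>(T(x a\<^sub>l))\<close> when \<open>l\<close> is the first index with \<open>T(x a\<^sub>l) \<noteq> 0\<close>, and \<open>\<chi>(y)\<close> on the elements
  \<open>w + b y\<close> of \<open>W\<^sup>\<bottom> = W + K b\<close>. Translating by the isotropic vectors \<open>a\<^sub>j\<close> shows that at most
  one of these pieces contributes: the one indexed by the first \<open>l\<close> with \<open>T(\<gamma> a\<^sub>l) \<noteq> 0\<close>, or
  \<open>W\<^sup>\<bottom>\<close> if there is none. On it the sum over translates \<open>x + s a\<^sub>l\<close> is a Gauss sum, and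
  completing the square reduces the rest to quadratic Gauss sums along \<open>b\<close>; the
  result is \<open>\<plusminus>g q\<^sup>k\<close>, or \<open>0\<close> if \<open>T(\<gamma>\<^sup>2) = 0\<close>. Since \<open>m\<close> is odd, \<open>-1\<close> is a square in \<open>GF(q\<^sup>m)\<close>
  iff it is one in \<open>K\<close>, so \<open>g q\<^sup>k\<close> and the Gauss sum of the big field have equal squares.\<close>

section \<open>Quadratic Gauss sums\<close>

text \<open>A carrier set rather than a type, so that the same theory serves \<open>Fq q\<close> and
  the whole field, whose Gauss sums are compared at the end.\<close>

locale finite_subfield =
  fixes K :: "'a::field set"
  assumes finite_K: "finite K"
    and zero_K: "0 \<in> K" and one_K: "1 \<in> K"
    and add_K: "x \<in> K \<Longrightarrow> y \<in> K \<Longrightarrow> x + y \<in> K"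
    and mult_K: "x \<in> K \<Longrightarrow> y \<in> K \<Longrightarrow> x * y \<in> K"
    and uminus_K: "x \<in> K \<Longrightarrow> - x \<in> K"
    and inverse_K: "x \<in> K \<Longrightarrow> inverse x \<in> K"
    and two_neq_0: "(2::'a) \<noteq> 0"
begin

lemma diff_K: "x \<in> K \<Longrightarrow> y \<in> K \<Longrightarrow> x - y \<in> K"
  using add_K[of x "- y"] uminus_K[of y] by simp

lemma divide_K: "x \<in> K \<Longrightarrow> y \<in> K \<Longrightarrow> x / y \<in> K"
  using mult_K[of x "inverse y"] inverse_K[of y] by (simp add: divide_inverse)

lemma power_K: "x \<in> K \<Longrightarrow> x ^ n \<in> K"
  by (induction n) (auto intro: one_K mult_K)

lemma two_K: "2 \<in> K"
  using add_K[OF one_K one_K] by simp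

lemmas K_intros = zero_K one_K two_K add_K mult_K uminus_K inverse_K diff_K divide_K power_K

lemma K_nonempty: "K \<noteq> {}"
  using zero_K by auto

lemma bij_betw_translate: "c \<in> K \<Longrightarrow> bij_betw (\<lambda>x. x + c) K K"
  by (rule bij_betw_byWitness[where f' = "\<lambda>x. x - c"]) (auto intro: K_intros)

lemma bij_betw_scale: "c \<in> K \<Longrightarrow> c \<noteq> 0 \<Longrightarrow> bij_betw (\<lambda>x. c * x) K K"
  by (rule bij_betw_byWitness[where f' = "\<lambda>x. x / c"]) (auto intro: K_intros)

definition squares :: "'a set" where
  "squares = (\<lambda>y. y ^ 2) ` (K - {0})"

definition quad_char :: "'a \<Rightarrow> complex" where
  "quad_char x = (if x = 0 then 0 else if x \<in> squares then 1 else -1)"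

lemma squares_subset: "squares \<subseteq> K - {0}"
  by (auto simp: squares_def intro: K_intros)

lemma neg_neq_self: "x \<noteq> 0 \<Longrightarrow> - x \<noteq> (x::'a)"
  using two_neq_0 by (metis add.right_inverse mult_2 mult_eq_0_iff)

lemma square_fibre:
  assumes "y \<in> K" "y \<noteq> 0"
  shows "{z \<in> K. z ^ 2 = y ^ 2} = {y, - y}" "card {z \<in> K. z ^ 2 = y ^ 2} = 2"
proof -
  show 1: "{z \<in> K. z ^ 2 = y ^ 2} = {y, - y}"
    using assms by (auto simp: power2_eq_iff intro: K_intros)
  show "card {z \<in> K. z ^ 2 = y ^ 2} = 2"
    unfolding 1 using neg_neq_self[OF assms(2)] by (simp add: card_insert_if)
qed

text \<open>An element \<open>u\<close> of \<open>K\<close> has \<open>1 + quad_char u\<close>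
  square roots in \<open>K\<close>: one if it is 0, otherwise two or none.\<close>

lemma sum_over_squares:
  fixes f :: "'a \<Rightarrow> complex"
  shows "(\<Sum>y\<in>K. f (y ^ 2)) = (\<Sum>u\<in>K. (1 + quad_char u) * f u)"
proof -
  have "(\<Sum>y\<in>K. f (y ^ 2)) = (\<Sum>u\<in>K. \<Sum>y\<in>{y \<in> K. y ^ 2 = u}. f (y ^ 2))"
    by (rule sum.group[symmetric]) (auto intro: finite_K K_intros)
  also have "\<dots> = (\<Sum>u\<in>K. (1 + quad_char u) * f u)"
  proof (rule sum.cong[OF refl])
    fix u assume u: "u \<in> K"
    have "(\<Sum>y\<in>{y \<in> K. y ^ 2 = u}. f (y ^ 2)) = of_nat (card {y \<in> K. y ^ 2 = u}) * f u"
      by simp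
    also have "of_nat (card {y \<in> K. y ^ 2 = u}) = 1 + quad_char u"
    proof (cases "u = 0")
      case True
      then have "{y \<in> K. y ^ 2 = u} = {0}" by (auto intro: zero_K)
      then show ?thesis using True by (simp add: quad_char_def)
    next
      case False
      show ?thesis
      proof (cases "u \<in> squares")
        case True
        then obtain y where "y \<in> K" "y \<noteq> 0" "u = y ^ 2" by (auto simp: squares_def)
        then show ?thesis using square_fibre(2)[of y] True False by (simp add: quad_char_def)
      next
        case nsq: False
        then have empty: "{y \<in> K. y ^ 2 = u} = {}" using False by (auto simp: squares_def)
        show ?thesis unfolding empty using nsq False by (simp add: quad_char_def)
      qed
    qed
    finally show "(\<Sum>y\<in>{y \<in> K. y ^ 2 = u}. f (y ^ 2)) = (1 + quad_char u) * f u" .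
  qed
  finally show ?thesis .
qed

lemma sum_quad_char: "(\<Sum>u\<in>K. quad_char u) = 0"
  using sum_over_squares[of "\<lambda>_. 1"] by (simp add: sum.distrib)

text \<open>The values 1 and -1 of the character balance, since it sums to 0 over
  \<open>K\<close>.\<close>

lemma card_squares: "card (K - {0} - squares) = card squares"
proof -
  have "(\<Sum>u\<in>K. quad_char u) = (\<Sum>u\<in>squares. quad_char u) + (\<Sum>u\<in>K - squares. quad_char u)"
    using sum.subset_diff[of squares K quad_char] squares_subset finite_K
    by (subst add.commute) blast
  also have "(\<Sum>u\<in>squares. quad_char u) = of_nat (card squares)"
    using squares_subset by (subst sum.cong[where h = "\<lambda>_. 1"]) (auto simp: quad_char_def)
  also have "(\<Sum>u\<in>K - squares. quad_char u) = (\<Sum>u\<in>K - {0} - squares. quad_char u)"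
    by (rule sum.mono_neutral_right) (auto simp: finite_K quad_char_def)
  also have "\<dots> = - of_nat (card (K - {0} - squares))"
    by (subst sum.cong[where h = "\<lambda>_. -1"]) (auto simp: quad_char_def)
  finally have "(of_nat (card squares) :: complex) = of_nat (card (K - {0} - squares))"
    unfolding sum_quad_char by simp
  then show ?thesis by (simp only: of_nat_eq_iff)
qed

lemma quad_char_0 [simp]: "quad_char 0 = 0"
  by (simp add: quad_char_def)

lemma quad_char_square_self: "x \<noteq> 0 \<Longrightarrow> quad_char x * quad_char x = 1"
  by (simp add: quad_char_def)

lemma squares_mult_squares: "x \<in> squares \<Longrightarrow> y \<in> squares \<Longrightarrow> x * y \<in> squares"
  unfolding squares_def by (auto simp flip: power_mult_distrib intro!: imageI K_intros)

lemma squares_mult_cancel: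
  assumes "x \<in> squares" "y \<in> K" "x * y \<in> squares" shows "y \<in> squares"
proof -
  from assms obtain u v where uv: "u \<in> K" "u \<noteq> 0" "x = u ^ 2" "v \<in> K" "v \<noteq> 0" "x * y = v ^ 2"
    by (auto simp: squares_def)
  then have "y = (v / u) ^ 2" by (simp add: power_divide eq_divide_eq mult.commute)
  moreover have "v / u \<in> K - {0}" using uv by (auto intro: K_intros)
  ultimately show ?thesis unfolding squares_def by blast
qed

text \<open>Multiplication by a nonsquare maps the squares injectively into the nonsquares,
  hence onto them, by \<open>card_squares\<close>.\<close>
lemma nonsquares_mult_nonsquares:
  assumes "x \<in> K" "x \<noteq> 0" "x \<notin> squares" "y \<in> K" "y \<noteq> 0" "y \<notin> squares"
  shows "x * y \<in> squares"
proof -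
  have sub: "(\<lambda>s. x * s) ` squares \<subseteq> K - {0} - squares"
    using assms squares_subset squares_mult_cancel[of _ x] by (auto simp: mult.commute intro: K_intros)
  moreover have "card ((\<lambda>s. x * s) ` squares) = card squares"
    by (rule card_image) (use assms in \<open>auto simp: inj_on_def\<close>)
  ultimately have "(\<lambda>s. x * s) ` squares = K - {0} - squares"
    using card_squares finite_K by (intro card_subset_eq) auto
  then obtain s where s: "s \<in> squares" "y = x * s" using assms by auto
  have "x ^ 2 \<in> squares" using assms by (auto simp: squares_def)
  then have "x ^ 2 * s \<in> squares" using s squares_mult_squares by blast
  then show ?thesis using s by (simp add: power2_eq_square mult.assoc)
qed

lemma quad_char_mult:
  assumes "x \<in> K" "y \<in> K"
  shows "quad_char (x * y) = quad_char x * quad_char y"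
  using assms nonsquares_mult_nonsquares[of x y] squares_mult_squares[of x y]
    squares_mult_cancel[of x y] squares_mult_cancel[of y x]
  by (auto simp: quad_char_def mult.commute)

lemma quad_char_inverse: "x \<in> K \<Longrightarrow> quad_char (inverse x) = quad_char x"
  using quad_char_mult[of x "inverse x"] quad_char_mult[of 1 1]
  by (cases "x = 0") (auto simp: quad_char_def one_K inverse_K split: if_splits)

lemma quad_char_divide: "x \<in> K \<Longrightarrow> y \<in> K \<Longrightarrow> quad_char (x / y) = quad_char x * quad_char y"
  by (simp add: divide_inverse quad_char_mult inverse_K quad_char_inverse)

end

section \<open>Additive characters and Gauss sums of \<open>K\<close>\<close>

locale subfield_character = finite_subfield K for K :: "'a::field set" +
  fixes lam :: "'a \<Rightarrow> complex"
  assumes lam_add: "x \<in> K \<Longrightarrow> y \<in> K \<Longrightarrow> lam (x + y) = lam x * lam y"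
    and lam_0: "lam 0 = 1"
    and lam_nontrivial: "\<exists>x\<in>K. lam x \<noteq> 1"
begin

lemma lam_nontrivial_scaled: "c \<in> K \<Longrightarrow> c \<noteq> 0 \<Longrightarrow> \<exists>s\<in>K. lam (s * c) \<noteq> 1"
  using lam_nontrivial by (metis divide_K nonzero_eq_divide_eq)

text \<open>Shifting the summation variable by some \<open>t\<close> with
  \<open>lam (t * c) \<noteq> 1\<close> multiplies the sum by that value.\<close>

lemma sum_lam_eq_0:
  assumes "c \<in> K" "c \<noteq> 0"
  shows "(\<Sum>s\<in>K. lam (s * c)) = 0"
proof -
  obtain t where t: "t \<in> K" "lam (t * c) \<noteq> 1" using lam_nontrivial_scaled assms by blast
  have "(\<Sum>s\<in>K. lam (s * c)) = (\<Sum>s\<in>K. lam ((s + t) * c))"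
    by (rule sum.reindex_bij_betw[OF bij_betw_translate, symmetric]) fact
  also have "\<dots> = (\<Sum>s\<in>K. lam (s * c)) * lam (t * c)"
    unfolding sum_distrib_right using assms t
    by (intro sum.cong) (auto simp: distrib_right intro!: lam_add K_intros)
  finally show ?thesis using t by simp
qed

definition gauss :: complex where
  "gauss = (\<Sum>u\<in>K. quad_char u * lam u)"

text \<open>Substituting \<open>c * u\<close> for \<open>u\<close> in \<open>gauss\<close> pulls out
  the sign \<open>quad_char c\<close>; for \<open>c = 0\<close> both sides are 0 by
  \<open>sum_quad_char\<close>.\<close>

lemma sum_quad_char_lam:
  assumes "c \<in> K"
  shows "(\<Sum>u\<in>K. quad_char u * lam (u * c)) = quad_char c * gauss"
proof (cases "c = 0")
  case True
  then show ?thesis by (simp add: lam_0 sum_quad_char)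
next
  case False
  have "quad_char c * gauss = quad_char c * (\<Sum>u\<in>K. quad_char (c * u) * lam (c * u))"
    unfolding gauss_def
    by (subst sum.reindex_bij_betw[OF bij_betw_scale[OF assms False], symmetric]) simp
  also have "\<dots> = (\<Sum>u\<in>K. (quad_char c * quad_char c) * (quad_char u * lam (u * c)))"
    unfolding sum_distrib_left using assms
    by (intro sum.cong) (auto simp: quad_char_mult mult_ac)
  also have "\<dots> = (\<Sum>u\<in>K. quad_char u * lam (u * c))"
    using False by (simp add: quad_char_square_self)
  finally show ?thesis by simp
qed

text \<open>Expanding one factor and absorbing the other by \<open>sum_quad_char_lam\<close> gives a
  double sum in which orthogonality of \<open>lam\<close> leaves only \<open>u = -1\<close>.\<close>

lemma gauss_square: "gauss * gauss = quad_char (-1) * of_nat (card K)"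
proof -
  have "gauss * gauss = (\<Sum>c\<in>K. lam c * (quad_char c * gauss))"
    by (subst gauss_def) (simp add: sum_distrib_left sum_distrib_right mult_ac)
  also have "\<dots> = (\<Sum>c\<in>K. \<Sum>u\<in>K. quad_char u * lam (c * (1 + u)))"
    using sum_quad_char_lam
    by (intro sum.cong)
      (auto simp: distrib_left lam_add mult_K sum_distrib_left mult_ac simp flip: sum_quad_char_lam)
  also have "\<dots> = (\<Sum>u\<in>K. quad_char u * (\<Sum>c\<in>K. lam (c * (1 + u))))"
    by (subst sum.swap) (simp add: sum_distrib_left)
  also have "\<dots> = (\<Sum>u\<in>K. if u = -1 then quad_char (-1) * of_nat (card K) else 0)"
  proof (rule sum.cong[OF refl])
    fix u assume u: "u \<in> K"
    show "quad_char u * (\<Sum>c\<in>K. lam (c * (1 + u))) =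
        (if u = -1 then quad_char (-1) * of_nat (card K) else 0)"
    proof (cases "u = -1")
      case True
      then show ?thesis by (simp add: lam_0)
    next
      case False
      then have "1 + u \<noteq> 0" by (metis add_eq_0_iff)
      then show ?thesis using sum_lam_eq_0[of "1 + u"] u False by (simp add: K_intros)
    qed
  qed
  also have "\<dots> = quad_char (-1) * of_nat (card K)"
    using finite_K K_intros by (simp add: sum.delta)
  finally show ?thesis .
qed

text \<open>The summand 1 in the weight \<open>1 + quad_char u\<close> of
  \<open>sum_over_squares\<close> contributes a vanishing character sum.\<close>

lemma sum_lam_square:
  assumes "c \<in> K" "c \<noteq> 0"
  shows "(\<Sum>y\<in>K. lam (y ^ 2 * c)) = quad_char c * gauss"
  using sum_over_squares[of "\<lambda>u. lam (u * c)"] sum_lam_eq_0[OF assms] sum_quad_char_lam[OF assms(1)]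
  by (simp add: distrib_right sum.distrib)

end

section \<open>The Fourier transform along an isotropic flag\<close>

text \<open>The bilinear form \<open>T (x * y)\<close> in dimension \<open>2 * k + 1\<close> over
  \<open>K\<close>: the \<open>a i\<close> span a maximal totally isotropic subspace, and
  \<open>b\<close> is an anisotropic vector orthogonal to it.\<close>

locale isotropic_flag = subfield_character K lam
  for K :: "'a::{field,finite} set" and lam :: "'a \<Rightarrow> complex" +
  fixes T :: "'a \<Rightarrow> 'a" and k :: nat and a :: "nat \<Rightarrow> 'a" and b :: 'a
  assumes T_K: "T x \<in> K"
    and T_add: "T (x + y) = T x + T y"
    and T_scale: "c \<in> K \<Longrightarrow> T (c * x) = c * T x"
    and T_nonzero: "\<exists>x. T x \<noteq> 0"
    and card_field: "CARD('a) = card K ^ (2 * k + 1)"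
    and isotropic: "i \<in> {1..k} \<Longrightarrow> j \<in> {1..k} \<Longrightarrow> T (a i * a j) = 0"
    and independent: "(\<And>i. i \<in> {1..k} \<Longrightarrow> v i \<in> K) \<Longrightarrow> (\<Sum>i\<in>{1..k}. v i * a i) = 0 \<Longrightarrow>
      j \<in> {1..k} \<Longrightarrow> v j = 0"
    and orthogonal: "j \<in> {1..k} \<Longrightarrow> T (b * a j) = 0"
    and anisotropic: "T (b ^ 2) \<noteq> 0"
begin

lemma T_0 [simp]: "T 0 = 0"
  using T_add[of 0 0] by (metis add_0 add_cancel_right_left)

lemma T_uminus: "T (- x) = - T x"
  using T_add[of x "- x"] by (simp add: eq_neg_iff_add_eq_0 add.commute)

lemma T_diff: "T (x - y) = T x - T y"
  using T_add[of x "- y"] by (simp add: T_uminus)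

lemma T_sum: "T (sum f S) = (\<Sum>i\<in>S. T (f i))"
  by (induction S rule: infinite_finite_induct) (auto simp: T_add)

lemma T_scale_mid: "c \<in> K \<Longrightarrow> T (x * (c * y)) = c * T (x * y)"
  using T_scale[of c "x * y"] by (simp add: mult_ac)

lemma T_nondegenerate: "x \<noteq> 0 \<Longrightarrow> \<exists>y. T (x * y) \<noteq> 0"
  using T_nonzero by (metis nonzero_mult_div_cancel_left times_divide_eq_right)

section \<open>Levels of the flag\<close>

definition V :: "nat \<Rightarrow> 'a set" where
  "V l = {x. \<forall>j\<in>{1..<l}. T (x * a j) = 0}"

text \<open>For \<open>l\<close> in \<open>{1..k}\<close>: the \<open>x\<close> whose first nonzero
  \<open>T (x * a j)\<close> occurs at \<open>j = l\<close>. These sets and \<open>V (Suc k)\<close>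
  partition the field, \<open>V 1\<close> being everything.\<close>

definition L :: "nat \<Rightarrow> 'a set" where
  "L l = {x \<in> V l. T (x * a l) \<noteq> 0}"

lemma sum_V_step:
  fixes h :: "'a \<Rightarrow> complex"
  assumes "l \<ge> 1" shows "sum h (V l) = sum h (L l) + sum h (V (Suc l))"
proof -
  have "V l = L l \<union> V (Suc l)" "L l \<inter> V (Suc l) = {}"
    using assms by (auto simp: V_def L_def less_Suc_eq)
  then show ?thesis by (simp add: sum.union_disjoint)
qed

lemma sum_V_levels:
  fixes h :: "'a \<Rightarrow> complex"
  assumes "l \<le> k" shows "sum h (V (Suc l)) = (\<Sum>j\<in>{Suc l..k}. sum h (L j)) + sum h (V (Suc k))"
  using assms
proof (induction rule: inc_induct)
  case base
  then show ?case by simp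
next
  case (step n)
  then show ?case
    using sum_V_step[of "Suc n" h] by (simp add: sum.atLeast_Suc_atMost[of "Suc n" k])
qed

lemma sum_translate:
  fixes h :: "'a \<Rightarrow> complex"
  assumes "\<And>x s. x \<in> S \<Longrightarrow> s \<in> K \<Longrightarrow> x + s * u \<in> S" "s \<in> K"
  shows "(\<Sum>x\<in>S. h (x + s * u)) = sum h S"
proof (rule sum.reindex_bij_betw)
  have "x - s * u \<in> S" if "x \<in> S" for x
    using assms(1)[OF that uminus_K[OF assms(2)]] by simp
  then show "bij_betw (\<lambda>x. x + s * u) S S"
    using assms by (intro bij_betw_byWitness[where f' = "\<lambda>x. x - s * u"]) auto
qed

text \<open>Spreads a sum over lines in direction \<open>u\<close>, so that the inner sums over
  \<open>s\<close> become character or Gauss sums over \<open>K\<close>.\<close>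

lemma sum_average:
  fixes h :: "'a \<Rightarrow> complex"
  assumes "\<And>x s. x \<in> S \<Longrightarrow> s \<in> K \<Longrightarrow> x + s * u \<in> S"
  shows "of_nat (card K) * sum h S = (\<Sum>x\<in>S. \<Sum>s\<in>K. h (x + s * u))"
  by (subst sum.swap) (simp add: sum_translate[OF assms])

text \<open>A suitable translation permutes \<open>S\<close> and multiplies the sum by a value other
  than 1.\<close>

lemma sum_translate_eq_0:
  fixes h :: "'a \<Rightarrow> complex"
  assumes "\<And>x s. x \<in> S \<Longrightarrow> s \<in> K \<Longrightarrow> x + s * u \<in> S"
    and "\<And>x s. x \<in> S \<Longrightarrow> s \<in> K \<Longrightarrow> h (x + s * u) = h x * lam (s * c)"
    and "c \<in> K" "c \<noteq> 0"
  shows "sum h S = 0"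
proof -
  obtain s where s: "s \<in> K" "lam (s * c) \<noteq> 1" using lam_nontrivial_scaled assms by blast
  have "sum h S = (\<Sum>x\<in>S. h x * lam (s * c))"
    using sum_translate[OF assms(1) s(1), where h = h] s assms(2) by simp
  also have "\<dots> = sum h S * lam (s * c)" by (simp add: sum_distrib_right)
  finally show ?thesis using s by simp
qed

section \<open>The isotropic span and its orthogonal complement\<close>

definition W :: "'a set" where
  "W = (\<lambda>x. \<Sum>i\<in>{1..k}. x i * a i) ` ({1..k} \<rightarrow>\<^sub>E K)"

lemma W_I:
  assumes "\<And>i. i \<in> {1..k} \<Longrightarrow> x i \<in> K" shows "(\<Sum>i\<in>{1..k}. x i * a i) \<in> W"
  unfolding W_def
  by (rule image_eqI[of _ _ "restrict x {1..k}"]) (use assms in \<open>auto intro!: sum.cong\<close>)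

lemma W_E:
  assumes "w \<in> W"
  shows "\<exists>x. (\<forall>i\<in>{1..k}. x i \<in> K) \<and> w = (\<Sum>i\<in>{1..k}. x i * a i)"
  using assms unfolding W_def by (auto simp: PiE_iff)

lemma W_add:
  assumes "u \<in> W" "w \<in> W" shows "u + w \<in> W"
proof -
  from assms(1) obtain x where x: "\<forall>i\<in>{1..k}. x i \<in> K" "u = (\<Sum>i\<in>{1..k}. x i * a i)"
    using W_E by blast
  from assms(2) obtain y where y: "\<forall>i\<in>{1..k}. y i \<in> K" "w = (\<Sum>i\<in>{1..k}. y i * a i)"
    using W_E by blast
  have "u + w = (\<Sum>i\<in>{1..k}. (x i + y i) * a i)"
    by (simp add: x(2) y(2) distrib_right sum.distrib)
  then show ?thesis using W_I[of "\<lambda>i. x i + y i"] x(1) y(1) by (simp add: add_K)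
qed

lemma W_scale:
  assumes "w \<in> W" "c \<in> K" shows "c * w \<in> W"
proof -
  from assms(1) obtain x where x: "\<forall>i\<in>{1..k}. x i \<in> K" "w = (\<Sum>i\<in>{1..k}. x i * a i)"
    using W_E by blast
  have "c * w = (\<Sum>i\<in>{1..k}. (c * x i) * a i)"
    by (simp add: x(2) sum_distrib_left mult.assoc)
  then show ?thesis using W_I[of "\<lambda>i. c * x i"] x(1) assms(2) by (simp add: mult_K)
qed

lemma W_0: "0 \<in> W"
  using W_I[of "\<lambda>_. 0"] by (simp add: zero_K)

lemma W_basis: "j \<in> {1..k} \<Longrightarrow> a j \<in> W"
  using W_I[of "\<lambda>i. if i = j then 1 else 0"] by (simp add: if_distrib[of "\<lambda>x. x * _"] K_intros cong: if_cong)

text \<open>Independence makes the coefficients unique; being extensional functions, they are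
  counted by \<open>card_PiE\<close>.\<close>

lemma card_W: "card W = card K ^ k"
proof -
  have "inj_on (\<lambda>x. \<Sum>i\<in>{1..k}. x i * a i) ({1..k} \<rightarrow>\<^sub>E K)"
  proof (rule inj_onI)
    fix x y assume x: "x \<in> {1..k} \<rightarrow>\<^sub>E K" and y: "y \<in> {1..k} \<rightarrow>\<^sub>E K"
      and eq: "(\<Sum>i\<in>{1..k}. x i * a i) = (\<Sum>i\<in>{1..k}. y i * a i)"
    have "(\<Sum>i\<in>{1..k}. (x i - y i) * a i) = 0"
      using eq by (simp add: left_diff_distrib sum_subtractf)
    then have "x i - y i = 0" if "i \<in> {1..k}" for i
      using independent[of "\<lambda>i. x i - y i" i] x y that by (auto simp: PiE_iff diff_K)
    then show "x = y" using x y by (intro PiE_ext) auto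
  qed
  then show ?thesis
    unfolding W_def by (simp add: card_image card_PiE)
qed

lemma T_perp_W: "x \<in> V (Suc k) \<Longrightarrow> w \<in> W \<Longrightarrow> T (x * w) = 0"
  using W_E[of w] by (auto simp: sum_distrib_left T_sum T_scale_mid V_def intro!: sum.neutral)

lemma W_isotropic: "w \<in> W \<Longrightarrow> i \<in> {1..k} \<Longrightarrow> T (w * a i) = 0"
  using T_perp_W[of "a i" w] isotropic by (auto simp: V_def mult.commute)

lemma W_subset_perp: "W \<subseteq> V (Suc k)"
  using W_isotropic by (auto simp: V_def)

lemma b_perp: "b \<in> V (Suc k)"
  using orthogonal by (auto simp: V_def)

lemma V_add: "x \<in> V l \<Longrightarrow> y \<in> V l \<Longrightarrow> x + y \<in> V l"
  by (auto simp: V_def distrib_right T_add)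

lemma V_scale: "x \<in> V l \<Longrightarrow> c \<in> K \<Longrightarrow> c * x \<in> V l"
  by (auto simp: V_def mult.assoc T_scale)

lemma V_scale_right: "x \<in> V l \<Longrightarrow> c \<in> K \<Longrightarrow> x * c \<in> V l"
  using V_scale[of x l c] by (simp add: mult.commute)

text \<open>Off \<open>V (Suc k)\<close> some \<open>a j\<close>, itself in \<open>W\<close>, gives
  a translation of \<open>W\<close> that kills the sum.\<close>

lemma sum_lam_W:
  "(\<Sum>w\<in>W. lam (T (x * w))) = (if x \<in> V (Suc k) then of_nat (card W) else 0)"
proof (cases "x \<in> V (Suc k)")
  case True
  then show ?thesis by (simp add: T_perp_W lam_0)
next
  case False
  then obtain j where j: "j \<in> {1..k}" "T (x * a j) \<noteq> 0" by (auto simp: V_def less_Suc_eq_le)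
  have "(\<Sum>w\<in>W. lam (T (x * w))) = 0"
  proof (rule sum_translate_eq_0[where u = "a j" and c = "T (x * a j)"])
    show "w + s * a j \<in> W" if "w \<in> W" "s \<in> K" for w s
      using that W_add W_scale W_basis j by blast
    show "lam (T (x * (w + s * a j))) = lam (T (x * w)) * lam (s * T (x * a j))"
      if "s \<in> K" for w s
      using that by (simp add: distrib_left T_add T_scale_mid lam_add T_K mult_K)
  qed (use j T_K in auto)
  then show ?thesis using False by simp
qed

lemma sum_lam_UNIV:
  "(\<Sum>x\<in>UNIV. lam (T (x * w))) = (if w = 0 then of_nat CARD('a) else 0)"
proof (cases "w = 0")
  case True
  then show ?thesis by (simp add: lam_0)
next
  case False
  then obtain u where u: "T (w * u) \<noteq> 0" using T_nondegenerate by blast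
  have "(\<Sum>x\<in>UNIV. lam (T (x * w))) = 0"
  proof (rule sum_translate_eq_0[where u = u and c = "T (w * u)"])
    show "lam (T ((x + s * u) * w)) = lam (T (x * w)) * lam (s * T (w * u))"
      if "s \<in> K" for x s
      using that T_scale_mid[of s w u]
      by (simp add: distrib_left T_add lam_add T_K mult_K mult.commute[of _ w])
  qed (use u T_K in auto)
  then show ?thesis using False by simp
qed

text \<open>Summing \<open>lam (T (x * w))\<close> over all \<open>x\<close> and all
  \<open>w\<close> in \<open>W\<close> in both orders yields the dimension formula for an orthogonal
  complement.\<close>

lemma card_perp: "card (V (Suc k)) = card K ^ Suc k"
proof -
  have "(\<Sum>x\<in>UNIV. \<Sum>w\<in>W. lam (T (x * w))) = of_nat (card (V (Suc k)) * card W)"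
    by (simp add: sum_lam_W sum.If_cases)
  moreover have "(\<Sum>x\<in>UNIV. \<Sum>w\<in>W. lam (T (x * w))) = of_nat CARD('a)"
    by (subst sum.swap) (simp add: sum_lam_UNIV W_0)
  ultimately have "card (V (Suc k)) * card W = CARD('a)" by (metis of_nat_eq_iff)
  also have "\<dots> = card K ^ Suc k * card W"
    by (simp add: card_field card_W mult_2 power_add)
  finally have "card (V (Suc k)) * card W = card K ^ Suc k * card W" .
  moreover have "card W \<noteq> 0" using zero_K finite_K by (auto simp: card_W)
  ultimately show ?thesis by (simp only: mult_cancel2 if_False simp_thms)
qed

lemma T_b_decomp:
  assumes "w \<in> W" "y \<in> K" shows "T ((w + b * y) * b) = y * T (b ^ 2)"
proof -
  have "(w + b * y) * b = b * w + y * b ^ 2"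
    by (simp add: power2_eq_square algebra_simps)
  then show ?thesis
    using T_perp_W[OF b_perp assms(1)] T_scale[OF assms(2)] by (simp add: T_add)
qed

text \<open>Pairing with \<open>b\<close> recovers \<open>y\<close>, since \<open>b\<close> is
  anisotropic and orthogonal to \<open>W\<close>; surjectivity then follows by counting.\<close>

lemma bij_betw_perp: "bij_betw (\<lambda>(w, y). w + b * y) (W \<times> K) (V (Suc k))"
proof -
  have inj: "inj_on (\<lambda>(w, y). w + b * y) (W \<times> K)"
  proof (rule inj_onI, clarify)
    fix w y w' y' assume *: "w \<in> W" "y \<in> K" "w' \<in> W" "y' \<in> K" "w + b * y = w' + b * y'"
    then have "y * T (b ^ 2) = y' * T (b ^ 2)" by (metis T_b_decomp)
    then show "w = w' \<and> y = y'" using * anisotropic by simp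
  qed
  have "(\<lambda>(w, y). w + b * y) ` (W \<times> K) \<subseteq> V (Suc k)"
    using W_subset_perp b_perp by (auto intro!: V_add V_scale_right)
  moreover have "card ((\<lambda>(w, y). w + b * y) ` (W \<times> K)) = card (V (Suc k))"
    unfolding card_image[OF inj] by (simp add: card_cartesian_product card_W card_perp)
  ultimately have "(\<lambda>(w, y). w + b * y) ` (W \<times> K) = V (Suc k)"
    by (intro card_subset_eq) auto
  with inj show ?thesis by (simp add: bij_betw_def)
qed

lemma sum_perp:
  fixes h :: "'a \<Rightarrow> complex"
  shows "sum h (V (Suc k)) = (\<Sum>w\<in>W. \<Sum>y\<in>K. h (w + b * y))"
  unfolding sum.cartesian_product sum.reindex_bij_betw[OF bij_betw_perp, symmetric]
  by (rule sum.cong) auto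

lemma perp_decomp:
  assumes "x \<in> V (Suc k)"
  obtains w y where "w \<in> W" "y \<in> K" "x = w + b * y"
proof -
  have "x \<in> (\<lambda>(w, y). w + b * y) ` (W \<times> K)"
    unfolding bij_betw_imp_surj_on[OF bij_betw_perp] by fact
  then show ?thesis using that by auto
qed

lemma T_square_decomp:
  assumes "w \<in> W" "y \<in> K" shows "T ((w + b * y) ^ 2) = y ^ 2 * T (b ^ 2)"
proof -
  have "(w + b * y) ^ 2 = w * w + (2 * y) * (b * w) + y ^ 2 * b ^ 2"
    by (simp add: power2_eq_square algebra_simps)
  moreover have "T (w * w) = 0" "T (b * w) = 0"
    using assms W_subset_perp b_perp by (auto intro: T_perp_W)
  moreover have "2 * y \<in> K" "y ^ 2 \<in> K" using assms by (auto intro: K_intros)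
  ultimately show ?thesis by (simp add: T_add T_scale)
qed

section \<open>Sums along isotropic translations\<close>

lemma T_translate:
  "s \<in> K \<Longrightarrow> i \<in> {1..k} \<Longrightarrow> j \<in> {1..k} \<Longrightarrow> T ((x + s * a i) * a j) = T (x * a j)"
  by (simp add: distrib_right T_add mult.assoc T_scale isotropic)

text \<open>Isotropy of \<open>a i\<close> removes the term in \<open>s ^ 2\<close>, so
  \<open>T (x ^ 2)\<close> is affine along these lines.\<close>

lemma T_square_translate:
  assumes "s \<in> K" "i \<in> {1..k}"
  shows "T ((x + s * a i) ^ 2) = T (x ^ 2) + s * (2 * T (x * a i))"
proof -
  have "(x + s * a i) ^ 2 = x ^ 2 + (s * 2) * (x * a i) + s ^ 2 * (a i * a i)"
    by (simp add: power2_eq_square algebra_simps)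
  then show ?thesis
    using assms isotropic[of i i]
    by (simp add: T_add T_scale[of "s * 2"] T_scale[of "s ^ 2"] K_intros)
qed

lemma V_translate: "s \<in> K \<Longrightarrow> i \<in> {1..k} \<Longrightarrow> l \<le> Suc k \<Longrightarrow> x \<in> V l \<Longrightarrow> x + s * a i \<in> V l"
  by (auto simp: V_def T_translate)

lemma L_translate: "s \<in> K \<Longrightarrow> i \<in> {1..k} \<Longrightarrow> l \<in> {1..k} \<Longrightarrow> x \<in> L l \<Longrightarrow> x + s * a i \<in> L l"
  by (auto simp: L_def T_translate V_translate)

lemma lam_T_translate:
  "s \<in> K \<Longrightarrow> lam (T (\<gamma> * (x + s * u))) = lam (T (\<gamma> * x)) * lam (s * T (\<gamma> * u))"
  by (simp add: distrib_left T_add T_scale_mid lam_add T_K mult_K)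

text \<open>Along \<open>a l\<close> the exponent is affine in \<open>s\<close> with slope
  \<open>2 * T (x * a l) * c\<close>, nonzero on \<open>L l\<close>, so every line sums to
  0.\<close>

lemma sum_lam_square_L:
  assumes "l \<in> {1..k}" "c \<in> K" "c \<noteq> 0"
  shows "(\<Sum>x\<in>L l. lam (T (x ^ 2) * c)) = 0"
proof -
  have "of_nat (card K) * (\<Sum>x\<in>L l. lam (T (x ^ 2) * c)) =
      (\<Sum>x\<in>L l. \<Sum>s\<in>K. lam (T ((x + s * a l) ^ 2) * c))"
    using assms by (intro sum_average L_translate)
  also have "\<dots> = (\<Sum>x\<in>L l. lam (T (x ^ 2) * c) * (\<Sum>s\<in>K. lam (s * (2 * T (x * a l) * c))))"
    unfolding sum_distrib_left using assms
    by (intro sum.cong refl)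
      (simp add: T_square_translate distrib_right lam_add mult.assoc K_intros T_K)
  also have "\<dots> = 0"
    using assms two_neq_0 by (intro sum.neutral) (auto simp: L_def sum_lam_eq_0 K_intros T_K)
  finally show ?thesis using K_nonempty finite_K by simp
qed

text \<open>The levels inside \<open>V (Suc l)\<close> contribute nothing. On
  \<open>V (Suc k)\<close> the exponent depends only on the coordinate along \<open>b\<close>, which
  gives \<open>card W\<close> copies of a Gauss sum, whatever \<open>l\<close> is.\<close>

lemma sum_lam_square_V:
  assumes "l \<le> k" "c \<in> K" "c \<noteq> 0"
  shows "(\<Sum>x\<in>V (Suc l). lam (T (x ^ 2) * c)) =
    of_nat (card K ^ k) * quad_char (T (b ^ 2)) * quad_char c * gauss"
proof -
  have "(\<Sum>x\<in>V (Suc l). lam (T (x ^ 2) * c)) = (\<Sum>x\<in>V (Suc k). lam (T (x ^ 2) * c))"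
    unfolding sum_V_levels[OF assms(1)] using assms by (simp add: sum_lam_square_L)
  also have "\<dots> = (\<Sum>w\<in>W. \<Sum>y\<in>K. lam (y ^ 2 * (T (b ^ 2) * c)))"
    by (simp add: sum_perp T_square_decomp mult.assoc)
  also have "\<dots> = of_nat (card K ^ k) * (quad_char (T (b ^ 2) * c) * gauss)"
    using assms anisotropic by (simp add: sum_lam_square T_K mult_K card_W)
  finally show ?thesis using assms by (simp add: quad_char_mult T_K mult_ac)
qed

text \<open>Substitute \<open>r = u + s * v\<close> and apply \<open>sum_quad_char_lam\<close> with
  \<open>c = d / v\<close>.\<close>

lemma sum_affine_quad_char:
  assumes "u \<in> K" "v \<in> K" "v \<noteq> 0" "d \<in> K"
  shows "(\<Sum>s\<in>K. quad_char (u + s * v) * lam (s * d)) =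
    lam (- (u * d / v)) * quad_char (d / v) * gauss"
proof -
  have bij: "bij_betw (\<lambda>s. u + s * v) K K"
    by (rule bij_betw_byWitness[where f' = "\<lambda>r. (r - u) / v"])
      (use assms in \<open>auto intro!: K_intros\<close>)
  have "lam (- (u * d / v)) * quad_char (d / v) * gauss =
      lam (- (u * d / v)) * (\<Sum>r\<in>K. quad_char r * lam (r * (d / v)))"
    using assms by (subst sum_quad_char_lam) (auto intro: divide_K)
  also have "\<dots> = (\<Sum>s\<in>K. quad_char (u + s * v) * (lam (- (u * d / v)) * lam ((u + s * v) * (d / v))))"
    by (subst sum.reindex_bij_betw[OF bij, symmetric]) (simp add: sum_distrib_left mult_ac)
  also have "\<dots> = (\<Sum>s\<in>K. quad_char (u + s * v) * lam (s * d))"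
    using assms by (intro sum.cong refl) (simp add: lam_add[symmetric] K_intros field_simps)
  finally show ?thesis by simp
qed

section \<open>Transform of a function prescribed on the levels\<close>

context
  fixes F :: "'a \<Rightarrow> complex" and \<gamma> :: 'a
  assumes F_level: "\<And>l x. l \<in> {1..k} \<Longrightarrow> x \<in> L l \<Longrightarrow>
      F x = quad_char (T (x ^ 2)) * quad_char (T (x * a l))"
    and F_perp: "\<And>x. x \<in> V (Suc k) \<Longrightarrow> F x = quad_char (T (x * b)) * quad_char (T (b ^ 2))"
begin

text \<open>On \<open>L l\<close>, translation along an earlier \<open>a j\<close> preserves
  \<open>T (x ^ 2)\<close> and \<open>T (x * a l)\<close>, hence \<open>F\<close>, while the
  character picks up the factor \<open>lam (s * T (\<gamma> * a j))\<close>.\<close>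

lemma level_sum_eq_0:
  assumes "l \<in> {1..k}" "j \<in> {1..<l}" "T (\<gamma> * a j) \<noteq> 0"
  shows "(\<Sum>x\<in>L l. F x * lam (T (\<gamma> * x))) = 0"
proof (rule sum_translate_eq_0[where u = "a j" and c = "T (\<gamma> * a j)"])
  show tr: "x + s * a j \<in> L l" if "x \<in> L l" "s \<in> K" for x s
    using that assms by (auto intro: L_translate)
  fix x s assume x: "x \<in> L l" "s \<in> K"
  have "T (x * a j) = 0" using x assms by (auto simp: L_def V_def)
  then have "F (x + s * a j) = F x"
    using x assms F_level[OF assms(1)] tr[of x s] by (simp add: T_translate T_square_translate)
  then show "F (x + s * a j) * lam (T (\<gamma> * (x + s * a j))) = F x * lam (T (\<gamma> * x)) * lam (s * T (\<gamma> * a j))"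
    using x by (simp add: lam_T_translate)
qed (use assms T_K in auto)

text \<open>Along \<open>a l\<close> the value \<open>T (x * a l)\<close> is constant and
  \<open>T (x ^ 2)\<close> is affine, so each line gives a Gauss sum. The sign of
  \<open>T (x * a l)\<close> enters once through \<open>F\<close> and once through that sum, and
  cancels.\<close>

lemma level_sum:
  assumes l: "l \<in> {1..k}"
  shows "of_nat (card K) * (\<Sum>x\<in>L l. F x * lam (T (\<gamma> * x))) =
    quad_char 2 * quad_char (T (\<gamma> * a l)) * gauss *
    (\<Sum>x\<in>L l. lam (T (\<gamma> * x) - T (x ^ 2) * T (\<gamma> * a l) / (2 * T (x * a l))))"
proof -
  have "of_nat (card K) * (\<Sum>x\<in>L l. F x * lam (T (\<gamma> * x))) =
      (\<Sum>x\<in>L l. \<Sum>s\<in>K. F (x + s * a l) * lam (T (\<gamma> * (x + s * a l))))"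
    using l by (intro sum_average L_translate)
  also have "\<dots> = (\<Sum>x\<in>L l. quad_char 2 * quad_char (T (\<gamma> * a l)) * gauss *
      lam (T (\<gamma> * x) - T (x ^ 2) * T (\<gamma> * a l) / (2 * T (x * a l))))"
  proof (rule sum.cong[OF refl])
    fix x assume x: "x \<in> L l"
    define \<beta> where "\<beta> = T (x * a l)"
    have \<beta>: "\<beta> \<noteq> 0" "\<beta> \<in> K" using x by (auto simp: L_def \<beta>_def T_K)
    have "(\<Sum>s\<in>K. F (x + s * a l) * lam (T (\<gamma> * (x + s * a l)))) =
        quad_char \<beta> * lam (T (\<gamma> * x)) *
        (\<Sum>s\<in>K. quad_char (T (x ^ 2) + s * (2 * \<beta>)) * lam (s * T (\<gamma> * a l)))"
      unfolding sum_distrib_left using l x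
      by (intro sum.cong refl)
        (simp add: F_level[OF l] L_translate T_square_translate T_translate lam_T_translate \<beta>_def)
    also have "\<dots> = quad_char \<beta> * lam (T (\<gamma> * x)) * (lam (- (T (x ^ 2) * T (\<gamma> * a l) / (2 * \<beta>))) *
        quad_char (T (\<gamma> * a l) / (2 * \<beta>)) * gauss)"
      using \<beta> two_neq_0 by (subst sum_affine_quad_char) (auto intro: K_intros T_K)
    also have "\<dots> = (quad_char \<beta> * quad_char \<beta>) * quad_char 2 * quad_char (T (\<gamma> * a l)) * gauss *
        (lam (T (\<gamma> * x)) * lam (- (T (x ^ 2) * T (\<gamma> * a l) / (2 * \<beta>))))"
      using \<beta> by (simp add: quad_char_divide quad_char_mult K_intros T_K mult_ac)
    also have "\<dots> = quad_char 2 * quad_char (T (\<gamma> * a l)) * gauss *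
      lam (T (\<gamma> * x) - T (x ^ 2) * T (\<gamma> * a l) / (2 * \<beta>))"
      using \<beta> by (simp add: quad_char_square_self lam_add[symmetric] K_intros T_K)
    finally show "(\<Sum>s\<in>K. F (x + s * a l) * lam (T (\<gamma> * (x + s * a l)))) =
        quad_char 2 * quad_char (T (\<gamma> * a l)) * gauss *
        lam (T (\<gamma> * x) - T (x ^ 2) * T (\<gamma> * a l) / (2 * T (x * a l)))"
      by (simp add: \<beta>_def)
  qed
  finally show ?thesis by (simp add: sum_distrib_left)
qed

text \<open>The exponent in \<open>level_sum\<close> becomes \<open>c (T (\<gamma>\<^sup>2) - T (z\<^sup>2))\<close> after
  completing the square with \<open>x = 2 c (\<gamma> - z)\<close>.\<close>
lemma first_level_sum:
  assumes l: "l \<in> {1..k}" and \<gamma>: "\<gamma> \<in> V l" and \<delta>: "T (\<gamma> * a l) \<noteq> 0"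
  shows "(\<Sum>x\<in>L l. lam (T (\<gamma> * x) - T (x ^ 2) * T (\<gamma> * a l) / (2 * T (x * a l)))) =
    of_nat (card K ^ Suc k) * quad_char (T (b ^ 2)) * quad_char (T (\<gamma> ^ 2))"
proof -
  define \<delta> where "\<delta> = T (\<gamma> * a l)"
  have \<delta>: "\<delta> \<noteq> 0" "\<delta> \<in> K" using assms by (auto simp: \<delta>_def T_K)
  have sub: "2 * c * (\<gamma> - z) \<in> L l" "T (2 * c * (\<gamma> - z) * a l) = 2 * c * \<delta>"
    if "c \<in> K - {0}" "z \<in> V (Suc l)" for c z
  proof -
    have *: "T (2 * c * (\<gamma> - z) * a j) = 2 * c * (T (\<gamma> * a j) - T (z * a j))" for j
      using T_scale[of "2 * c" "(\<gamma> - z) * a j"] that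
      by (simp add: left_diff_distrib T_diff K_intros mult.assoc)
    show "2 * c * (\<gamma> - z) \<in> L l" "T (2 * c * (\<gamma> - z) * a l) = 2 * c * \<delta>"
      using * that l \<gamma> \<delta> two_neq_0 by (auto simp: L_def V_def \<delta>_def[symmetric])
  qed
  \<comment> \<open>As \<open>z\<close> is orthogonal to \<open>a l\<close>, pairing
    \<open>x\<close> with \<open>a l\<close> gives \<open>2 * c * \<delta>\<close>; this recovers
    \<open>c\<close>, and then \<open>z\<close>.\<close>
  have bij: "bij_betw (\<lambda>(c, z). 2 * c * (\<gamma> - z)) ((K - {0}) \<times> V (Suc l)) (L l)"
  proof (rule bij_betw_byWitness[where
        f' = "\<lambda>x. (T (x * a l) / (2 * \<delta>), \<gamma> - \<delta> / T (x * a l) * x)"])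
    show "(\<lambda>(c, z). 2 * c * (\<gamma> - z)) ` ((K - {0}) \<times> V (Suc l)) \<subseteq> L l"
      using sub by auto
    show "\<forall>cz\<in>(K - {0}) \<times> V (Suc l). (\<lambda>x. (T (x * a l) / (2 * \<delta>), \<gamma> - \<delta> / T (x * a l) * x))
        ((\<lambda>(c, z). 2 * c * (\<gamma> - z)) cz) = cz"
      using sub(2) \<delta> two_neq_0 by (auto simp: field_simps)
    show "\<forall>x\<in>L l. (\<lambda>(c, z). 2 * c * (\<gamma> - z))
        ((\<lambda>x. (T (x * a l) / (2 * \<delta>), \<gamma> - \<delta> / T (x * a l) * x)) x) = x"
      using \<delta> two_neq_0 by (auto simp: L_def)
    show "(\<lambda>x. (T (x * a l) / (2 * \<delta>), \<gamma> - \<delta> / T (x * a l) * x)) ` L l \<subseteq> (K - {0}) \<times> V (Suc l)"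
    proof (rule image_subsetI)
      fix x assume x: "x \<in> L l"
      then have \<beta>: "T (x * a l) \<noteq> 0" "T (x * a l) \<in> K" by (auto simp: L_def T_K)
      have "T ((\<gamma> - \<delta> / T (x * a l) * x) * a j) = T (\<gamma> * a j) - \<delta> / T (x * a l) * T (x * a j)" for j
        using T_scale[of "\<delta> / T (x * a l)" "x * a j"] \<beta> \<delta>
        by (simp only: left_diff_distrib T_diff K_intros mult.assoc)
      then have "\<gamma> - \<delta> / T (x * a l) * x \<in> V (Suc l)"
        using x \<gamma> \<beta> by (auto simp: V_def L_def \<delta>_def less_Suc_eq)
      then show "(T (x * a l) / (2 * \<delta>), \<gamma> - \<delta> / T (x * a l) * x) \<in> (K - {0}) \<times> V (Suc l)"
        using \<beta> \<delta> two_neq_0 by (auto intro!: K_intros)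
    qed
  qed
  \<comment> \<open>The factor 2 in the substitution is what makes the mixed terms
    \<open>T (\<gamma> * z)\<close> cancel.\<close>
  have expo: "T (\<gamma> * (2 * c * (\<gamma> - z))) - T ((2 * c * (\<gamma> - z)) ^ 2) * \<delta> / (2 * (2 * c * \<delta>)) =
      T (\<gamma> ^ 2) * c + T (z ^ 2) * (- c)" if "c \<in> K - {0}" for c z
  proof -
    have 1: "T (\<gamma> * (2 * c * (\<gamma> - z))) = 2 * c * (T (\<gamma> ^ 2) - T (\<gamma> * z))"
      using T_scale_mid[of "2 * c" \<gamma> "\<gamma> - z"] that
      by (simp add: K_intros right_diff_distrib T_diff power2_eq_square)
    have "(2 * c * (\<gamma> - z)) ^ 2 = (2 * c) ^ 2 * (\<gamma> ^ 2 - 2 * (\<gamma> * z) + z ^ 2)"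
      by (simp add: power2_eq_square algebra_simps)
    then have 2: "T ((2 * c * (\<gamma> - z)) ^ 2) = (2 * c) ^ 2 * (T (\<gamma> ^ 2) - 2 * T (\<gamma> * z) + T (z ^ 2))"
      using that T_scale[of 2 "\<gamma> * z"] T_scale[of "(2 * c) ^ 2"]
      by (simp only: T_add T_diff K_intros DiffD1)
    have 3: "(2 * c) ^ 2 * r * \<delta> / (2 * (2 * c * \<delta>)) = c * r" for r
      using that \<delta> two_neq_0 mult_eq_0_iff[of "2::'a" 2] by (simp add: power2_eq_square field_simps)
    show ?thesis unfolding 1 2 3 by (simp add: algebra_simps)
  qed
  have "(\<Sum>x\<in>L l. lam (T (\<gamma> * x) - T (x ^ 2) * T (\<gamma> * a l) / (2 * T (x * a l)))) =
      (\<Sum>(c, z)\<in>(K - {0}) \<times> V (Suc l). lam (T (\<gamma> ^ 2) * c + T (z ^ 2) * (- c)))"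
    unfolding sum.reindex_bij_betw[OF bij, symmetric]
  proof (rule sum.cong[OF refl], goal_cases)
    case (1 p)
    then obtain c z where p: "p = (c, z)" "c \<in> K - {0}" "z \<in> V (Suc l)" by blast
    show ?case
      unfolding p(1) prod.case \<delta>_def[symmetric] sub(2)[OF p(2,3)] expo[OF p(2)] ..
  qed
  also have "\<dots> = (\<Sum>c\<in>K - {0}. lam (T (\<gamma> ^ 2) * c) * (\<Sum>z\<in>V (Suc l). lam (T (z ^ 2) * (- c))))"
    unfolding sum.cartesian_product[symmetric] sum_distrib_left
    by (intro sum.cong refl lam_add) (auto intro: K_intros T_K simp del: mult_minus_right)
  also have "\<dots> = (\<Sum>c\<in>K - {0}. (of_nat (card K ^ k) * quad_char (T (b ^ 2)) * gauss * quad_char (-1)) *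
      (quad_char c * lam (c * T (\<gamma> ^ 2))))"
  proof (rule sum.cong[OF refl])
    fix c assume c: "c \<in> K - {0}"
    have "quad_char (- c) = quad_char (-1) * quad_char c"
      using quad_char_mult[of "-1" c] c by (simp add: K_intros)
    then show "lam (T (\<gamma> ^ 2) * c) * (\<Sum>z\<in>V (Suc l). lam (T (z ^ 2) * (- c))) =
        (of_nat (card K ^ k) * quad_char (T (b ^ 2)) * gauss * quad_char (-1)) *
        (quad_char c * lam (c * T (\<gamma> ^ 2)))"
      using c l by (subst sum_lam_square_V) (auto simp: K_intros mult_ac)
  qed
  \<comment> \<open>The term \<open>c = 0\<close> may be added because
    \<open>quad_char 0 = 0\<close>; the sum over \<open>c\<close> is then a second Gauss
    sum.\<close>
  also have "\<dots> = (of_nat (card K ^ k) * quad_char (T (b ^ 2)) * gauss * quad_char (-1)) *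
      (\<Sum>c\<in>K. quad_char c * lam (c * T (\<gamma> ^ 2)))"
    unfolding sum_distrib_left by (rule sum.mono_neutral_left) (auto simp: finite_K)
  also have "\<dots> = of_nat (card K ^ k) * quad_char (T (b ^ 2)) * quad_char (T (\<gamma> ^ 2)) *
      (quad_char (-1) * (gauss * gauss))"
    by (simp add: sum_quad_char_lam T_K mult_ac)
  also have "quad_char (-1) * (gauss * gauss) = of_nat (card K)"
    unfolding gauss_square mult.assoc[symmetric] by (simp add: quad_char_square_self)
  finally show ?thesis by (simp add: mult_ac)
qed

text \<open>In the coordinates \<open>w + b * y\<close> the function \<open>F\<close> is
  \<open>quad_char y\<close>, so the sum factors into a character sum over \<open>W\<close> and a
  Gauss sum in \<open>y\<close>.\<close>

lemma perp_sum:
  "(\<Sum>x\<in>V (Suc k). F x * lam (T (\<gamma> * x))) =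
    (if \<gamma> \<in> V (Suc k) then of_nat (card K ^ k) * quad_char (T (\<gamma> * b)) * gauss else 0)"
proof -
  have "(\<Sum>x\<in>V (Suc k). F x * lam (T (\<gamma> * x))) =
      (\<Sum>w\<in>W. \<Sum>y\<in>K. lam (T (\<gamma> * w)) * (quad_char y * lam (y * T (\<gamma> * b))))"
    unfolding sum_perp
  proof (intro sum.cong refl)
    fix w y assume wy: "w \<in> W" "y \<in> K"
    have "w + b * y \<in> V (Suc k)"
      using wy W_subset_perp by (auto intro!: V_add V_scale_right b_perp)
    then have "F (w + b * y) = quad_char y"
      using wy anisotropic
      by (simp add: F_perp T_b_decomp quad_char_mult T_K mult.assoc quad_char_square_self)
    then show "F (w + b * y) * lam (T (\<gamma> * (w + b * y))) =
        lam (T (\<gamma> * w)) * (quad_char y * lam (y * T (\<gamma> * b)))"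
      using wy lam_T_translate[of y \<gamma> w b] by (simp add: mult_ac)
  qed
  also have "\<dots> = (\<Sum>w\<in>W. lam (T (\<gamma> * w))) * (quad_char (T (\<gamma> * b)) * gauss)"
    by (simp add: sum_distrib_left[symmetric] sum_distrib_right[symmetric] sum_quad_char_lam T_K)
  finally show ?thesis by (simp add: sum_lam_W card_W)
qed

theorem transform_value:
  "(\<Sum>x\<in>UNIV. F x * lam (T (\<gamma> * x))) \<in>
    (if T (\<gamma> ^ 2) = 0 then {0} else {gauss * of_nat (card K ^ k), - (gauss * of_nat (card K ^ k))})"
proof -
  define S where "S l = (\<Sum>x\<in>L l. F x * lam (T (\<gamma> * x)))" for l
  have sign: "r * (gauss * of_nat (card K ^ k)) \<in> (if T (\<gamma> ^ 2) = 0 then {0}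
      else {gauss * of_nat (card K ^ k), - (gauss * of_nat (card K ^ k))})"
    if "if T (\<gamma> ^ 2) = 0 then r = 0 else r \<in> {1, -1}" for r
    using that by (auto split: if_splits)
  have pm: "quad_char u \<in> {1, -1}" if "u \<noteq> 0" for u
    using that by (auto simp: quad_char_def)
  have total: "(\<Sum>x\<in>UNIV. F x * lam (T (\<gamma> * x))) =
      (\<Sum>j\<in>{1..k}. S j) + (\<Sum>x\<in>V (Suc k). F x * lam (T (\<gamma> * x)))"
    using sum_V_levels[of 0 "\<lambda>x. F x * lam (T (\<gamma> * x))"] by (simp add: V_def S_def)
  \<comment> \<open>Here the right-hand side of \<open>level_sum\<close> has the factor
    \<open>quad_char 0\<close>.\<close>
  have S0: "S l = 0" if "l \<in> {1..k}" "T (\<gamma> * a l) = 0" for l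
    using level_sum[OF that(1)] that(2) K_nonempty finite_K by (simp add: S_def)
  show ?thesis
  proof (cases "\<gamma> \<in> V (Suc k)")
    case True
    then have "S l = 0" if "l \<in> {1..k}" for l
      using S0[OF that] that by (auto simp: V_def)
    then have eq: "(\<Sum>x\<in>UNIV. F x * lam (T (\<gamma> * x))) =
        quad_char (T (\<gamma> * b)) * (gauss * of_nat (card K ^ k))"
      unfolding total perp_sum using True by (simp add: mult_ac)
    from True obtain w y where wy: "w \<in> W" "y \<in> K" "\<gamma> = w + b * y" by (rule perp_decomp)
    \<comment> \<open>The two values are \<open>y * T (b ^ 2)\<close> and
      \<open>y ^ 2 * T (b ^ 2)\<close>.\<close>
    have "T (\<gamma> * b) = 0 \<longleftrightarrow> T (\<gamma> ^ 2) = 0"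
      using wy anisotropic by (simp add: T_square_decomp T_b_decomp)
    then show ?thesis unfolding eq
      using pm[of "T (\<gamma> * b)"] by (intro sign) auto
  next
    case False
    then have ex: "\<exists>l. l \<in> {1..k} \<and> T (\<gamma> * a l) \<noteq> 0" by (auto simp: V_def less_Suc_eq_le)
    define l where "l = (LEAST l. l \<in> {1..k} \<and> T (\<gamma> * a l) \<noteq> 0)"
    have l: "l \<in> {1..k}" "T (\<gamma> * a l) \<noteq> 0"
      using LeastI_ex[OF ex] by (auto simp: l_def)
    have min: "T (\<gamma> * a j) = 0" if "j \<in> {1..<l}" for j
    proof -
      have "j < l" "j \<in> {1..k}" using that l(1) by auto
      then show ?thesis unfolding l_def using not_less_Least by blast
    qed
    \<comment> \<open>Earlier levels vanish by minimality of \<open>l\<close>, later ones by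
      translation along \<open>a l\<close>.\<close>
    have "S j = 0" if "j \<in> {1..k} - {l}" for j
    proof (cases "j < l")
      case True
      then show ?thesis using S0[of j] min[of j] that by auto
    next
      case False
      then show ?thesis using level_sum_eq_0[of j l] that l by (auto simp: S_def)
    qed
    then have "(\<Sum>j\<in>{1..k}. S j) = S l"
      using l by (simp add: sum.remove[of _ l])
    \<comment> \<open>The factor \<open>card K\<close> matches \<open>level_sum\<close>; it cancels
      against the extra power in the \<open>card K ^ Suc k\<close> of
      \<open>first_level_sum\<close>.\<close>
    then have "of_nat (card K) * (\<Sum>x\<in>UNIV. F x * lam (T (\<gamma> * x))) = of_nat (card K) * S l"
      unfolding total perp_sum using False by simp
    also have "\<dots> = of_nat (card K) * (quad_char 2 * quad_char (T (\<gamma> * a l)) * quad_char (T (b ^ 2)) *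
        quad_char (T (\<gamma> ^ 2)) * (gauss * of_nat (card K ^ k)))"
      unfolding S_def level_sum[OF l(1)]
      using min l by (subst first_level_sum) (auto simp: V_def mult_ac)
    finally have eq: "(\<Sum>x\<in>UNIV. F x * lam (T (\<gamma> * x))) =
        quad_char 2 * quad_char (T (\<gamma> * a l)) * quad_char (T (b ^ 2)) * quad_char (T (\<gamma> ^ 2)) *
        (gauss * of_nat (card K ^ k))"
      using K_nonempty finite_K by simp
    show ?thesis unfolding eq
      by (rule sign) (use pm[OF two_neq_0] pm[OF l(2)] pm[OF anisotropic] pm[of "T (\<gamma> ^ 2)"] in auto)
  qed
qed

end

end

section \<open>Traces and additive characters of finite fields\<close>

lemma prime_CHAR_finite: "prime CHAR('a::{field,finite})"
  by (intro prime_CHAR_semidom finite_imp_CHAR_pos) simp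

text \<open>Multiplication by a nonzero \<open>x\<close> permutes the nonzero elements; compare
  their products.\<close>

lemma power_CARD_eq_same:
  fixes x :: "'a::{field,finite}"
  shows "x ^ CARD('a) = x"
proof (cases "x = 0")
  case False
  have "bij_betw (\<lambda>y. x * y) (UNIV - {0}) (UNIV - {0})"
    by (rule bij_betw_byWitness[where f' = "\<lambda>y. y / x"]) (use False in auto)
  then have "(\<Prod>y\<in>UNIV - {0}. x * y) = (\<Prod>y\<in>UNIV - {0::'a}. y)"
    by (rule prod.reindex_bij_betw[where g = "\<lambda>y. y"])
  then have "x ^ (CARD('a) - 1) = 1"
    by (simp add: prod.distrib card_Diff_singleton)
  then have "x ^ Suc (CARD('a) - 1) = x" by (simp only: power_Suc mult_1_right)
  then show ?thesis by (simp only: Suc_diff_1 zero_less_card_finite)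
qed (simp add: power_0_left)

text \<open>Serves both the relative trace, with \<open>r = q\<close>, and the absolute trace, with
  \<open>r = CHAR('a)\<close>.\<close>

locale frobenius_trace =
  fixes r f n :: nat and ty :: "'a::{field,finite} itself"
  assumes r_def: "r = CHAR('a) ^ f" and f_pos: "f > 0" and n_pos: "n > 0"
    and card_r: "CARD('a) = r ^ n"
begin

lemma r_gt_1: "r > 1"
  unfolding r_def using prime_gt_1_nat[OF prime_CHAR_finite] f_pos by (metis one_less_power)

lemma frobenius_add: "(x + y :: 'a) ^ (r ^ i) = x ^ (r ^ i) + y ^ (r ^ i)"
  by (rule freshmans_dream'[where n = "f * i"]) (auto simp: prime_CHAR_finite r_def power_mult)

lemma frobenius_sum: "(sum g A :: 'a) ^ r = (\<Sum>i\<in>A. g i ^ r)"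
  by (rule freshmans_dream_sum'[where n = f]) (auto simp: prime_CHAR_finite r_def)

lemma power_r_n: "(x::'a) ^ (r ^ n) = x"
  using power_CARD_eq_same[of x] by (simp add: card_r)

lemma zero_Fq: "(0::'a) \<in> Fq r" and one_Fq: "(1::'a) \<in> Fq r"
  using r_gt_1 by (auto simp: Fq_def)

lemma add_Fq: "x \<in> Fq r \<Longrightarrow> y \<in> Fq r \<Longrightarrow> (x + y :: 'a) \<in> Fq r"
  using frobenius_add[of x y 1] by (simp add: Fq_def)

lemma Fq_power: "(c::'a) \<in> Fq r \<Longrightarrow> c ^ (r ^ i) = c"
  by (induction i) (auto simp: Fq_def power_mult)

lemma rtr_add: "rtr r n (x + y :: 'a) = rtr r n x + rtr r n y"
  by (simp add: rtr_def frobenius_add sum.distrib)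

lemma rtr_scale: "c \<in> Fq r \<Longrightarrow> rtr r n (c * x :: 'a) = c * rtr r n x"
  by (simp add: rtr_def power_mult_distrib Fq_power sum_distrib_left)

lemma rtr_0: "rtr r n (0::'a) = 0"
  using r_gt_1 by (simp add: rtr_def power_0_left)

text \<open>Raising to the power \<open>r\<close> permutes the summands cyclically, because
  \<open>x ^ (r ^ n) = x\<close>.\<close>

lemma rtr_in_Fq: "rtr r n (x::'a) \<in> Fq r"
proof -
  have "rtr r n x ^ r = (\<Sum>i<n. x ^ (r ^ Suc i))"
    by (simp add: rtr_def frobenius_sum power_mult[symmetric] mult.commute)
  also have "x + \<dots> = (\<Sum>i<Suc n. x ^ (r ^ i))"
    by (subst sum.lessThan_Suc_shift) simp
  also have "\<dots> = x + rtr r n x"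
    by (simp add: rtr_def power_r_n)
  finally show ?thesis by (simp add: Fq_def)
qed

text \<open>The trace is a polynomial of degree \<open>r ^ (n - 1)\<close>, which bounds its
  zeros.\<close>

lemma card_rtr_kernel_le: "card {x::'a. rtr r n x = 0} \<le> r ^ (n - 1)"
proof -
  define P :: "'a poly" where "P = (\<Sum>i<n. monom 1 (r ^ i))"
  have poly: "poly P x = rtr r n x" for x
    by (simp add: P_def rtr_def poly_sum poly_monom)
  have "r ^ i = r ^ (n - 1) \<longleftrightarrow> i = n - 1" for i
    using r_gt_1 by (simp add: power_inject_exp)
  then have "coeff P (r ^ (n - 1)) = 1"
    using n_pos by (simp add: P_def coeff_sum)
  then have "P \<noteq> 0" by auto
  moreover have "degree P \<le> r ^ (n - 1)"
    unfolding P_def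
    by (rule degree_sum_le) (use r_gt_1 in \<open>auto intro!: order.trans[OF degree_monom_le] power_increasing\<close>)
  ultimately show ?thesis using card_poly_roots_bound[of P] by (simp add: poly)
qed

lemma card_Fq_le: "card (Fq r :: 'a set) \<le> r"
proof -
  define P :: "'a poly" where "P = monom 1 r - monom 1 1"
  have "coeff P r = 1" using r_gt_1 by (simp add: P_def)
  then have "P \<noteq> 0" by auto
  moreover have "degree P \<le> r"
    unfolding P_def using r_gt_1 by (intro degree_diff_le) (auto intro: order.trans[OF degree_monom_le])
  moreover have "Fq r = {x. poly P x = 0}"
    by (auto simp: Fq_def P_def poly_monom)
  ultimately show ?thesis using card_poly_roots_bound[of P] by simp
qed

text \<open>Each fibre lies in a translate of the kernel, so the \<open>r ^ n\<close> elements
  produce at least \<open>r\<close> values. All lie among the at most \<open>r\<close> roots of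
  \<open>X ^ r - X\<close>, which forces equality.\<close>

lemma card_Fq: "card (Fq r :: 'a set) = r"
  and range_rtr: "range (rtr r n) = (Fq r :: 'a set)"
proof -
  have sub: "range (rtr r n) \<subseteq> (Fq r :: 'a set)" using rtr_in_Fq by auto
  have fibre: "card {x::'a. rtr r n x = y} \<le> r ^ (n - 1)" if y: "y \<in> range (rtr r n)" for y
  proof -
    obtain x0 where x0: "y = rtr r n x0" using y by auto
    have "{x. rtr r n x = y} \<subseteq> (\<lambda>x. x + x0) ` {x. rtr r n x = 0}"
    proof
      fix x assume "x \<in> {x. rtr r n x = y}"
      then have "rtr r n (x - x0) = 0" using rtr_add[of "x - x0" x0] by (simp add: x0)
      then have "x - x0 \<in> {x. rtr r n x = 0}" by simp
      then have "(x - x0) + x0 \<in> (\<lambda>x. x + x0) ` {x. rtr r n x = 0}" by (rule imageI)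
      then show "x \<in> (\<lambda>x. x + x0) ` {x. rtr r n x = 0}" by simp
    qed
    then have "card {x. rtr r n x = y} \<le> card {x::'a. rtr r n x = 0}"
      by (meson card_image_le card_mono finite finite_imageI order.trans)
    then show ?thesis using card_rtr_kernel_le by simp
  qed
  have "r ^ n = (\<Sum>x\<in>(UNIV::'a set). 1)" using card_r by simp
  also have "\<dots> = (\<Sum>y\<in>range (rtr r n :: 'a \<Rightarrow> 'a). \<Sum>x\<in>{x. x \<in> UNIV \<and> rtr r n x = y}. 1)"
    by (rule sum.image_gen) simp
  also have "\<dots> \<le> (\<Sum>y\<in>range (rtr r n :: 'a \<Rightarrow> 'a). r ^ (n - 1))"
    by (rule sum_mono) (use fibre in auto)
  also have "\<dots> = card (range (rtr r n :: 'a \<Rightarrow> 'a)) * r ^ (n - 1)" by simp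
  finally have "r * r ^ (n - 1) \<le> card (range (rtr r n :: 'a \<Rightarrow> 'a)) * r ^ (n - 1)"
    using n_pos by (simp add: power_eq_if)
  then have ge: "r \<le> card (range (rtr r n :: 'a \<Rightarrow> 'a))"
    using r_gt_1 by simp
  have le: "card (range (rtr r n :: 'a \<Rightarrow> 'a)) \<le> card (Fq r :: 'a set)"
    by (rule card_mono[OF _ sub]) simp
  show "card (Fq r :: 'a set) = r" using ge le card_Fq_le by linarith
  then show "range (rtr r n) = (Fq r :: 'a set)"
    by (intro card_subset_eq sub) (use ge le in auto)
qed

end

text \<open>The shift \<open>x + 1\<close> permutes the field, so summing over it shows that
  \<open>CARD('a)\<close> is 0 there.\<close>

lemma CHAR_finite_field_eq:
  assumes "prime p" "CARD('a::{field,finite}) = p ^ d"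
  shows "CHAR('a) = p"
proof -
  have "(\<Sum>x\<in>(UNIV::'a set). x + 1) = (\<Sum>x\<in>UNIV. x)"
    by (rule sum.reindex_bij_betw[where g = "\<lambda>x. x"])
      (rule bij_betw_byWitness[where f' = "\<lambda>x. x - 1"], auto)
  then have "of_nat CARD('a) = (0::'a)" by (simp add: sum.distrib)
  then have "CHAR('a) dvd p ^ d" by (simp only: of_nat_eq_0_iff_char_dvd assms(2))
  then have "CHAR('a) dvd p" by (rule prime_dvd_power[OF prime_CHAR_finite])
  then show ?thesis by (rule primes_dvd_imp_eq[OF prime_CHAR_finite assms(1)])
qed

section \<open>The canonical additive character\<close>

locale absolute_trace = frobenius_trace "CHAR('a)" 1 n ty
  for n :: nat and ty :: "'a::{field,finite} itself"
begin

lemma abs_tr_eq: "abs_tr (x::'a) = rtr CHAR('a) n x"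
proof -
  have "(THE d. CHAR('a) ^ d = CARD('a)) = n"
    using r_gt_1 by (intro the_equality) (simp_all add: card_r)
  then show ?thesis by (simp add: abs_tr_def rtr_def)
qed

lemma of_nat_in_Fq: "(of_nat i :: 'a) \<in> Fq CHAR('a)"
  by (induction i) (auto intro: zero_Fq one_Fq add_Fq)

text \<open>Gives every absolute trace a representative below the characteristic, as the definite
  description in \<open>psi\<close> requires.\<close>

lemma Fq_eq_of_nat: "Fq CHAR('a) = (of_nat ` {..<CHAR('a)} :: 'a set)"
proof -
  have "inj_on (of_nat :: nat \<Rightarrow> 'a) {..<CHAR('a)}"
    by (auto simp: inj_on_def of_nat_eq_iff_cong_CHAR cong_def)
  then have "card (of_nat ` {..<CHAR('a)} :: 'a set) = card (Fq CHAR('a) :: 'a set)"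
    by (simp add: card_image card_Fq)
  then show ?thesis
    by (intro card_subset_eq[symmetric]) (auto intro: of_nat_in_Fq)
qed

text \<open>Any representative \<open>i\<close> of the trace will do: reducing it modulo the
  characteristic changes the angle by a multiple of \<open>2 * pi\<close>.\<close>

lemma psi_eq:
  assumes "abs_tr (x::'a) = of_nat i"
  shows "psi x = cis (2 * pi * real i / real CHAR('a))"
proof -
  have the: "(THE j. j < CHAR('a) \<and> of_nat j = abs_tr x) = i mod CHAR('a)"
    unfolding assms
    using r_gt_1 by (intro the_equality) (auto simp: of_nat_eq_iff_cong_CHAR cong_def)
  have "real i = real (i div CHAR('a)) * real CHAR('a) + real (i mod CHAR('a))"
    by (metis div_mult_mod_eq of_nat_add of_nat_mult)
  then have "2 * pi * real i / real CHAR('a) =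
      2 * pi * real (i mod CHAR('a)) / real CHAR('a) + 2 * pi * real (i div CHAR('a))"
    using r_gt_1 by (simp add: field_simps)
  then have "cis (2 * pi * real i / real CHAR('a)) =
      cis (2 * pi * real (i mod CHAR('a)) / real CHAR('a)) * cis (2 * pi * real (i div CHAR('a)))"
    by (simp only: cis_mult)
  then show ?thesis
    by (simp add: psi_def the)
qed

lemma abs_tr_of_nat: "\<exists>i. abs_tr (x::'a) = of_nat i"
  using rtr_in_Fq[of x] by (auto simp: abs_tr_eq Fq_eq_of_nat)

lemma psi_add: "psi (x + y :: 'a) = psi x * psi y"
proof -
  obtain i where i: "abs_tr x = of_nat i" using abs_tr_of_nat by blast
  obtain j where j: "abs_tr y = of_nat j" using abs_tr_of_nat by blast
  have ij: "abs_tr (x + y) = of_nat (i + j)"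
    using i j by (simp add: abs_tr_eq rtr_add)
  show ?thesis
    unfolding psi_eq[OF i] psi_eq[OF j] psi_eq[OF ij] cis_mult
    by (simp add: distrib_left add_divide_distrib)
qed

lemma psi_trace_0: "abs_tr (x::'a) = 0 \<Longrightarrow> psi x = 1"
  using psi_eq[of x 0] by simp

lemma psi_0: "psi (0::'a) = 1"
  by (rule psi_trace_0) (simp add: abs_tr_eq rtr_0)

text \<open>The trace is onto the prime field, so it takes the value 1, where \<open>psi\<close> is
  a root of unity other than 1.\<close>

lemma psi_nontrivial: "\<exists>x::'a. psi x \<noteq> 1"
proof -
  have "1 \<in> range (rtr CHAR('a) n :: 'a \<Rightarrow> 'a)" unfolding range_rtr by (rule one_Fq)
  then obtain x :: 'a where "abs_tr x = of_nat 1" by (auto simp: abs_tr_eq)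
  then have "psi x = cis (2 * pi * real 1 / real CHAR('a))" by (rule psi_eq)
  moreover have "cis (2 * pi * real 1 / real CHAR('a)) \<noteq> cis (2 * pi * real 0 / real CHAR('a))"
    using Complex.bij_betw_roots_unity[of "CHAR('a)"] r_gt_1
    by (subst inj_on_eq_iff[where f = "\<lambda>k. cis (2 * pi * real k / real CHAR('a))"
          and A = "{..<CHAR('a)}"]) (auto simp: bij_betw_def)
  ultimately have "psi x \<noteq> 1" by simp
  then show ?thesis by blast
qed

end

text \<open>Transitivity of the trace: grouping the exponents as \<open>j + s * e\<close> with
  \<open>j < e\<close> writes the absolute trace as a sum of the powers
  \<open>rtr q m x ^ (CHAR('a) ^ j)\<close>.\<close>

lemma abs_tr_eq_0_if_rtr_eq_0:
  fixes x :: "'a::{field,finite}"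
  assumes q: "q = CHAR('a) ^ e" and "CARD('a) = q ^ m" "rtr q m x = 0"
  shows "abs_tr x = 0"
proof -
  have p: "CHAR('a) > 1" using prime_CHAR_finite prime_gt_1_nat by blast
  then have the: "(THE d. CHAR('a) ^ d = CARD('a)) = m * e"
    using assms(2) by (intro the_equality) (simp_all add: q power_mult[symmetric] mult.commute)
  have "abs_tr x = (\<Sum>s<m. \<Sum>i\<in>{s * e..<s * e + e}. x ^ (CHAR('a) ^ i))"
    by (simp add: abs_tr_def the sum.nat_group)
  also have "\<dots> = (\<Sum>s<m. \<Sum>j<e. (x ^ (q ^ s)) ^ (CHAR('a) ^ j))"
  proof (rule sum.cong[OF refl])
    fix s
    have "(\<Sum>i\<in>{s * e..<s * e + e}. x ^ (CHAR('a) ^ i)) = (\<Sum>j<e. x ^ (CHAR('a) ^ (j + s * e)))"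
      using sum.shift_bounds_nat_ivl[of "\<lambda>i. x ^ (CHAR('a) ^ i)" 0 "s * e" e]
      by (simp add: add.commute lessThan_atLeast0)
    also have "\<dots> = (\<Sum>j<e. (x ^ (q ^ s)) ^ (CHAR('a) ^ j))"
      by (simp add: q power_mult[symmetric] power_add mult.commute)
    finally show "(\<Sum>i\<in>{s * e..<s * e + e}. x ^ (CHAR('a) ^ i)) =
        (\<Sum>j<e. (x ^ (q ^ s)) ^ (CHAR('a) ^ j))" .
  qed
  also have "\<dots> = (\<Sum>j<e. rtr q m x ^ (CHAR('a) ^ j))"
    unfolding rtr_def
    by (subst sum.swap) (intro sum.cong refl freshmans_dream_sum'[symmetric, OF prime_CHAR_finite refl])
  also have "\<dots> = 0"
    using assms(3) p by (simp add: power_0_left)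
  finally show ?thesis .
qed

section \<open>The set \<open>D\<close>\<close>

text \<open>Since \<open>y ^ q\<close> is again a square root of -1, it is \<open>y\<close> or
  \<open>- y\<close>; in the second case \<open>m\<close> iterations with \<open>m\<close> odd would
  give \<open>y ^ (q ^ m) = - y\<close>.\<close>

lemma sqrt_minus_one_fixed_by_frobenius:
  fixes y :: "'a::field"
  assumes "odd q" "odd m" "y ^ (q ^ m) = y" "(2::'a) \<noteq> 0" "y ^ 2 = -1"
  shows "y ^ q = y"
proof -
  have "(y ^ q) ^ 2 = (y ^ 2) ^ q"
    by (simp only: power_mult[symmetric] mult.commute)
  then have "(y ^ q) ^ 2 = y ^ 2"
    using assms(1,5) by simp
  then have "y ^ q = y \<or> y ^ q = - y" by (simp add: power2_eq_iff)
  moreover have False if neg: "y ^ q = - y"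
  proof -
    have pow: "y ^ (q ^ i) = (-1) ^ i * y" for i
    proof (induction i)
      case (Suc i)
      have "y ^ (q ^ Suc i) = (y ^ (q ^ i)) ^ q" by (simp only: power_Suc2 power_mult)
      also have "\<dots> = ((-1) ^ i) ^ q * (- y)" by (simp only: Suc power_mult_distrib neg)
      also have "((-1) ^ i) ^ q = ((-1) ^ i :: 'a)"
        using assms(1) by (cases "even i") simp_all
      finally show ?case by simp
    qed simp
    have "- y = (-1) ^ m * y" using assms(2) by simp
    also have "\<dots> = y ^ (q ^ m)" by (rule pow[symmetric])
    also have "\<dots> = y" by (rule assms(3))
    finally have "2 * y = 0" by (metis mult_2 right_minus)
    then show False using assms(4,5) by auto
  qed
  ultimately show ?thesis by blast
qed

lemma finite_subfield_UNIV:
  assumes "(2::'a::{field,finite}) \<noteq> 0"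
  shows "finite_subfield (UNIV :: 'a set)"
  by unfold_locales (use assms in auto)

lemma (in frobenius_trace) finite_subfield_Fq:
  assumes "odd CHAR('a)"
  shows "finite_subfield (Fq r :: 'a set)"
proof
  have "\<not> CHAR('a) dvd 2"
    using assms primes_dvd_imp_eq[OF prime_CHAR_finite[where 'a = 'a] two_is_prime_nat] by auto
  then show "(2::'a) \<noteq> 0" using of_nat_eq_0_iff_char_dvd[where ?'a = 'a, of 2] by simp
  have "odd r" using assms by (simp add: r_def)
  then show "- x \<in> Fq r" if "x \<in> Fq r" for x :: 'a using that by (simp add: Fq_def)
qed (auto simp: zero_Fq one_Fq add_Fq, auto simp: Fq_def power_mult_distrib power_inverse)

context finite_subfield
begin

lemma Csq_eq_squares:
  assumes "K = Fq q"
  shows "Csq q 0 = squares" "Csq q 1 = K - {0} - squares"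
  unfolding Csq_def assms[symmetric] squares_def by auto

end

lemma eta_eq_quad_char:
  assumes "(2::'a::{field,finite}) \<noteq> 0"
  shows "eta (x::'a) = finite_subfield.quad_char UNIV x"
proof -
  interpret finite_subfield "UNIV :: 'a set" by (rule finite_subfield_UNIV) fact
  have "(\<exists>y. x = y ^ 2) \<longleftrightarrow> x \<in> squares" if "x \<noteq> 0"
    using that by (auto simp: squares_def image_iff)
  then show ?thesis by (simp add: eta_def quad_char_def)
qed

section \<open>Membership in \<open>D\<close> level by level\<close>

context isotropic_flag
begin

context
  fixes q m :: nat
  assumes K_eq: "K = Fq q" and T_eq: "T = rtr q m"
begin

lemma T_sets:
  "Ajset q m 0 = {x. T (x ^ 2) \<in> squares}"
  "Ajset q m 1 = {x. T (x ^ 2) \<in> K - {0} - squares}"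
  "Hjset q m u 0 = {x. T (x * u) \<in> squares}"
  "Hjset q m u 1 = {x. T (x * u) \<in> K - {0} - squares}"
  "Hset q m u = {x. x \<noteq> 0 \<and> T (x * u) = 0}"
  using squares_subset
  by (auto simp: Ajset_def Hjset_def Hset_def Csq_eq_squares[OF K_eq] Csq_eq_squares[OF K_eq, simplified]
      simp flip: T_eq)

lemma Tset_iff:
  assumes "l \<in> {1..k}"
  shows "x \<in> Tset q m a l \<longleftrightarrow>
    x \<in> L l \<and> T (x ^ 2) \<noteq> 0 \<and> quad_char (T (x ^ 2)) = quad_char (T (x * a l))"
proof -
  have "x \<in> Tset q m a l \<longleftrightarrow> x \<in> (\<Inter>j\<in>{1..<l}. Hset q m (a j)) \<and>
      (T (x ^ 2) \<in> squares \<and> T (x * a l) \<in> squares \<or>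
       T (x ^ 2) \<in> K - {0} - squares \<and> T (x * a l) \<in> K - {0} - squares)"
    unfolding Tset_def T_sets by blast
  also have "(T (x ^ 2) \<in> squares \<and> T (x * a l) \<in> squares \<or>
       T (x ^ 2) \<in> K - {0} - squares \<and> T (x * a l) \<in> K - {0} - squares) \<longleftrightarrow>
      T (x * a l) \<noteq> 0 \<and> T (x ^ 2) \<noteq> 0 \<and> quad_char (T (x ^ 2)) = quad_char (T (x * a l))"
    using squares_subset T_K[of "x ^ 2"] T_K[of "x * a l"] by (auto simp: quad_char_def)
  finally show ?thesis by (auto simp: L_def V_def T_sets)
qed

lemma Bset_iff: "x \<in> Bset q k a b \<longleftrightarrow> (\<exists>w\<in>W. \<exists>y\<in>squares. x = w + b * y)"
proof
  assume "x \<in> Bset q k a b"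
  then obtain v y where "x = (\<Sum>i\<in>{1..k}. a i * v i) + b * y" "\<forall>i\<in>{1..k}. v i \<in> K" "y \<in> squares"
    by (auto simp: Bset_def Csq_eq_squares[OF K_eq] simp flip: K_eq)
  moreover from this have "(\<Sum>i\<in>{1..k}. a i * v i) \<in> W"
    using W_I[of v] by (simp add: mult.commute)
  ultimately show "\<exists>w\<in>W. \<exists>y\<in>squares. x = w + b * y" by blast
next
  assume "\<exists>w\<in>W. \<exists>y\<in>squares. x = w + b * y"
  then obtain w y where wy: "w \<in> W" "y \<in> squares" "x = w + b * y" by blast
  then obtain v where "\<forall>i\<in>{1..k}. v i \<in> K" "w = (\<Sum>i\<in>{1..k}. v i * a i)" using W_E by blast
  then show "x \<in> Bset q k a b"
    using wy unfolding Bset_def Csq_eq_squares[OF K_eq] K_eq[symmetric]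
    by (auto intro!: exI[of _ v] exI[of _ y] simp: mult.commute)
qed

lemma Bset_perp: "x \<in> Bset q k a b \<Longrightarrow> x \<in> V (Suc k)"
  using squares_subset W_subset_perp by (auto simp: Bset_iff intro!: V_add V_scale_right b_perp)

lemma L_not_perp: "l \<in> {1..k} \<Longrightarrow> x \<in> L l \<Longrightarrow> x \<notin> V (Suc k)"
  by (auto simp: L_def V_def)

lemma L_unique:
  assumes "x \<in> L l" "x \<in> L l'" "l \<in> {1..k}" "l' \<in> {1..k}" shows "l' = l"
proof (rule ccontr)
  assume "l' \<noteq> l"
  then consider "l' \<in> {1..<l}" | "l \<in> {1..<l'}" using assms(3,4) by fastforce
  then show False using assms(1,2) unfolding L_def V_def by cases blast+
qed

text \<open>The indicator of \<open>D\<close> minus that of its multiple by a nonsquare of \<open>K\<close>: these two sets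
  partition \<open>{x. T (x ^ 2) \<noteq> 0}\<close>.\<close>

definition sgn_D :: "'a \<Rightarrow> complex" where
  "sgn_D x = 2 * of_bool (x \<in> Dset q m k a b) - of_bool (T (x ^ 2) \<noteq> 0)"

text \<open>On \<open>L l\<close> only \<open>Tset q m a l\<close> meets \<open>D\<close>, and it
  selects the \<open>x\<close> at which the two characters agree; where \<open>T (x ^ 2) = 0\<close>
  both sides are 0.\<close>

lemma sgn_D_level:
  assumes "l \<in> {1..k}" "x \<in> L l"
  shows "sgn_D x = quad_char (T (x ^ 2)) * quad_char (T (x * a l))"
proof -
  have "x \<in> Dset q m k a b \<longleftrightarrow> x \<in> Tset q m a l"
    using assms L_not_perp[OF assms] L_unique[OF assms(2)] Bset_perp Tset_iff
    unfolding Dset_def by blast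
  moreover have "T (x * a l) \<noteq> 0" using assms by (simp add: L_def)
  ultimately show ?thesis
    using assms by (auto simp: sgn_D_def Tset_iff quad_char_def)
qed

text \<open>On \<open>V (Suc k)\<close> only \<open>Bset\<close> meets \<open>D\<close>, so the sign
  is \<open>quad_char y\<close>; \<open>y = T (x * b) / T (b ^ 2)\<close> makes it free of
  coordinates.\<close>

lemma sgn_D_perp:
  assumes "x \<in> V (Suc k)"
  shows "sgn_D x = quad_char (T (x * b)) * quad_char (T (b ^ 2))"
proof -
  obtain w y where wy: "w \<in> W" "y \<in> K" "x = w + b * y" using perp_decomp[OF assms] .
  have uniq: "y' = y" if "w' \<in> W" "y' \<in> K" "x = w' + b * y'" for w' y'
    using T_b_decomp[OF that(1,2)] T_b_decomp[OF wy(1,2)] that(3) wy(3) anisotropic by simp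
  have "x \<notin> Tset q m a l" if "l \<in> {1..k}" for l
    using that L_not_perp assms Tset_iff by blast
  then have "x \<in> Dset q m k a b \<longleftrightarrow> x \<in> Bset q k a b" by (auto simp: Dset_def)
  also have "\<dots> \<longleftrightarrow> y \<in> squares"
    using wy uniq squares_subset by (auto simp: Bset_iff)
  finally have "x \<in> Dset q m k a b \<longleftrightarrow> y \<in> squares" .
  moreover have "T (x ^ 2) \<noteq> 0 \<longleftrightarrow> y \<noteq> 0"
    using wy anisotropic by (simp add: T_square_decomp)
  ultimately have "sgn_D x = quad_char y"
    using squares_subset by (auto simp: sgn_D_def quad_char_def)
  moreover have "T (x * b) = y * T (b ^ 2)" using T_b_decomp[OF wy(1,2)] wy(3) by simp
  ultimately show ?thesis
    using wy anisotropic by (simp add: quad_char_mult T_K mult.assoc quad_char_square_self)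
qed

theorem psi_set_difference:
  assumes psi: "\<And>x. psi x = lam (T x)" and "\<gamma> \<noteq> 0"
  shows "2 * psi_set ((\<lambda>x. \<gamma> * x) ` Dset q m k a b) - psi_set ((\<lambda>x. \<gamma> * x) ` {x. T (x ^ 2) \<noteq> 0}) \<in>
    (if T (\<gamma> ^ 2) = 0 then {0} else {gauss * of_nat (card K ^ k), - (gauss * of_nat (card K ^ k))})"
proof -
  have image: "psi_set ((\<lambda>x. \<gamma> * x) ` S) = (\<Sum>x\<in>UNIV. of_bool (x \<in> S) * psi (\<gamma> * x))" for S
  proof -
    have "psi_set ((\<lambda>x. \<gamma> * x) ` S) = (\<Sum>x\<in>S. psi (\<gamma> * x))"
      unfolding psi_set_def using assms(2) by (subst sum.reindex) (auto simp: inj_on_def)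
    also have "\<dots> = (\<Sum>x\<in>UNIV. of_bool (x \<in> S) * psi (\<gamma> * x))"
      by (rule sum.mono_neutral_cong_left) auto
    finally show ?thesis .
  qed
  have "2 * psi_set ((\<lambda>x. \<gamma> * x) ` Dset q m k a b) - psi_set ((\<lambda>x. \<gamma> * x) ` {x. T (x ^ 2) \<noteq> 0}) =
      (\<Sum>x\<in>UNIV. sgn_D x * lam (T (\<gamma> * x)))"
    unfolding image sum_distrib_left sum_subtractf[symmetric]
    by (intro sum.cong refl) (simp add: sgn_D_def psi left_diff_distrib)
  then show ?thesis
    using transform_value[OF sgn_D_level sgn_D_perp, of \<gamma>] by simp
qed

end

end

section \<open>Cyclotomic classes and the two Gauss sums\<close>

theorem theorem7p4:
  fixes p e q m N k :: nat and \<omega> b :: "'a::{field,finite}" and a :: "nat \<Rightarrow> 'a" and c :: int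
  assumes "prime p" and "odd p" and "e > 0" and "q = p ^ e"
    and "CARD('a) = q ^ m" and "odd m" and "m > 1"
    and "N = (q ^ m - 1) div (q - 1)"
    and "\<forall>x::'a. x \<noteq> 0 \<longrightarrow> (\<exists>i::nat. x = \<omega> ^ i)"
    and "k = (m - 1) div 2"
    and "\<forall>l\<in>{1..k}. a l \<in> Aset q m \<and> (\<forall>j\<in>{1..<l}. a l \<in> Hset q m (a j))"
    and "\<forall>x::nat \<Rightarrow> 'a. (\<forall>i\<in>{1..k}. x i \<in> Fq q) \<and> (\<Sum>i\<in>{1..k}. x i * a i) = 0
            \<longrightarrow> (\<forall>i\<in>{1..k}. x i = 0)"
    and "b \<in> (\<Inter>l\<in>{1..k}. Hset q m (a l)) - Aset q m"
  shows "let I = {i. i < N \<and> rtr q m (\<omega> ^ i) = 0};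
             J = {u. u < N \<and> (2 * u) mod N \<in> I};
             U = (\<Union>t\<in>{..<N} - J. cyc \<omega> N t);
             val = 2 * psi_set ((\<lambda>x. \<omega> powi c * x) ` Dset q m k a b)
                   - psi_set ((\<lambda>x. \<omega> powi c * x) ` U)
         in (if nat (c mod int N) \<in> J then val = 0
             else val = gauss_eta TYPE('a) \<or> val = - gauss_eta TYPE('a))"
proof -
  have char: "CHAR('a) = p"
    by (rule CHAR_finite_field_eq[of p "e * m"]) (use assms(1,4,5) in \<open>simp_all add: power_mult\<close>)
  interpret tr: frobenius_trace q e m "TYPE('a)"
    by unfold_locales (use assms(3-5,7) char in auto)
  interpret ab: absolute_trace "e * m" "TYPE('a)"
    by unfold_locales (use assms(3-5,7) char in \<open>auto simp: power_mult\<close>)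
  interpret K: finite_subfield "Fq q :: 'a set"
    by (rule tr.finite_subfield_Fq) (use assms(2) char in simp)
  interpret G: subfield_character "UNIV :: 'a set" psi
    by (intro subfield_character.intro finite_subfield_UNIV K.two_neq_0, unfold_locales)
      (use ab.psi_add ab.psi_0 ab.psi_nontrivial in auto)
  obtain x0 :: 'a where x0: "rtr q m x0 = 1"
    using tr.range_rtr tr.one_Fq by (metis image_iff)
  \<comment> \<open>As \<open>x\<close> and \<open>rtr q m x * x0\<close> have the same relative
    trace, \<open>psi\<close> agrees on them; this factors \<open>psi\<close> through the relative
    trace.\<close>
  define lam where "lam u = psi (u * x0)" for u
  have psi: "psi x = lam (rtr q m x)" for x
  proof -
    have "rtr q m (x - rtr q m x * x0) = 0"
      using tr.rtr_add[of "x - rtr q m x * x0" "rtr q m x * x0"]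
      by (simp add: tr.rtr_scale tr.rtr_in_Fq x0)
    then have "psi (x - rtr q m x * x0) = 1"
      using assms(4,5) char by (intro ab.psi_trace_0 abs_tr_eq_0_if_rtr_eq_0[of q e m]) auto
    then show ?thesis
      using ab.psi_add[of "x - rtr q m x * x0" "rtr q m x * x0"] by (simp add: lam_def)
  qed
  have m_eq: "m = 2 * k + 1" using assms(6,10) by auto
  \<comment> \<open>With \<open>m > 1\<close> the intersection containing \<open>b\<close> has at
    least one \<open>Hset\<close>, and these exclude 0.\<close>
  then have "1 \<in> {1..k}" using assms(7) by auto
  then have "b \<noteq> 0" using assms(13) by (auto simp: Hset_def)
  interpret isotropic_flag "Fq q" lam "rtr q m" k a b
  proof unfold_locales
    show "lam (x + y) = lam x * lam y" for x y
      by (simp add: lam_def distrib_right ab.psi_add)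
    show "lam 0 = 1" by (simp add: lam_def ab.psi_0)
    show "\<exists>x\<in>Fq q. lam x \<noteq> 1"
      using ab.psi_nontrivial psi tr.rtr_in_Fq by metis
    show "rtr q m x \<in> Fq q" for x :: 'a by (rule tr.rtr_in_Fq)
    show "rtr q m (x + y) = rtr q m x + rtr q m y" for x y :: 'a by (rule tr.rtr_add)
    show "rtr q m (u * x) = u * rtr q m x" if "u \<in> Fq q" for u x :: 'a
      using that by (rule tr.rtr_scale)
    show "\<exists>x::'a. rtr q m x \<noteq> 0" using x0 by (intro exI[of _ x0]) simp
    show "CARD('a) = card (Fq q :: 'a set) ^ (2 * k + 1)"
      using assms(5) m_eq by (simp add: tr.card_Fq)
    have lt: "rtr q m (a i * a j) = 0" if "i \<in> {1..k}" "j \<in> {1..<i}" for i j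
      using assms(11) that by (auto simp: Hset_def)
    show "rtr q m (a i * a j) = 0" if ij: "i \<in> {1..k}" "j \<in> {1..k}" for i j
    proof (cases i j rule: linorder_cases)
      case less
      then show ?thesis using lt[of j i] ij by (simp add: mult.commute)
    next
      case equal
      then show ?thesis using assms(11) ij by (auto simp: Aset_def power2_eq_square)
    next
      case greater
      then show ?thesis using lt[of i j] ij by simp
    qed
    show "v j = 0" if "\<And>i. i \<in> {1..k} \<Longrightarrow> v i \<in> Fq q" "(\<Sum>i\<in>{1..k}. v i * a i) = 0" "j \<in> {1..k}"
      for v j
      using assms(12) that by blast
    show "rtr q m (b * a j) = 0" if "j \<in> {1..k}" for j
      using assms(13) that by (auto simp: Hset_def)
    show "rtr q m (b ^ 2) \<noteq> 0"
      using assms(13) \<open>b \<noteq> 0\<close> by (auto simp: Aset_def)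
  qed
  have q1: "q > 1" by (rule tr.r_gt_1)

  \<comment> \<open>Each Gauss sum squares to \<open>quad_char (-1)\<close> times the size of its
    field, so the character of -1 must agree in both fields.\<close>
  have minus_one: "K.quad_char (-1) = G.quad_char (-1)"
  proof -
    have "-1 \<in> K.squares \<longleftrightarrow> -1 \<in> G.squares"
    proof
      assume "-1 \<in> G.squares"
      then obtain y :: 'a where y: "-1 = y ^ 2" "y \<noteq> 0" unfolding G.squares_def by blast
      have "y ^ q = y"
        by (rule sqrt_minus_one_fixed_by_frobenius[of q m])
          (use assms(2,4,6) y tr.power_r_n K.two_neq_0 in auto)
      then have "y \<in> Fq q - {0}" using y(2) by (simp add: Fq_def)
      then show "-1 \<in> K.squares" unfolding K.squares_def y(1) by (rule imageI)
    qed (auto simp: K.squares_def G.squares_def)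
    then show ?thesis by (simp add: K.quad_char_def G.quad_char_def)
  qed
  have G_eq: "gauss_eta TYPE('a) = G.gauss"
    unfolding gauss_eta_def G.gauss_def eta_eq_quad_char[OF K.two_neq_0]
    by (rule sum.mono_neutral_left) auto
  have "(gauss * of_nat (card (Fq q :: 'a set) ^ k)) ^ 2 = (gauss_eta TYPE('a)) ^ 2"
  proof -
    have "(gauss * of_nat (card (Fq q :: 'a set) ^ k)) ^ 2 = (gauss * gauss) * of_nat (q ^ k * q ^ k)"
      by (simp add: power2_eq_square tr.card_Fq mult_ac)
    also have "\<dots> = K.quad_char (-1) * of_nat (q ^ m)"
      by (simp add: gauss_square tr.card_Fq m_eq mult_2 power_add)
    also have "\<dots> = (gauss_eta TYPE('a)) ^ 2"
      using assms(5) by (simp add: G_eq power2_eq_square G.gauss_square minus_one)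
    finally show ?thesis .
  qed
  then have gauss_pm: "gauss * of_nat (card (Fq q :: 'a set) ^ k) = gauss_eta TYPE('a) \<or>
      gauss * of_nat (card (Fq q :: 'a set) ^ k) = - gauss_eta TYPE('a)"
    by (simp only: power2_eq_iff)

  \<comment> \<open>The powers of 0 are only 0 and 1, and 2 is neither.\<close>
  have \<omega>: "\<omega> \<noteq> 0"
  proof
    assume "\<omega> = 0"
    obtain i where "(2::'a) = \<omega> ^ i" using assms(9) K.two_neq_0 by blast
    moreover have "(2::'a) \<noteq> 1" by (metis add_cancel_left_right one_add_one zero_neq_one)
    ultimately show False using \<open>\<omega> = 0\<close> K.two_neq_0 by (cases i) auto
  qed
  \<comment> \<open>The division defining \<open>N\<close> is exact, as \<open>q\<close> is 1 modulo
    \<open>q - 1\<close>.\<close>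
  have N: "N * (q - 1) = q ^ m - 1" "N > 0"
  proof -
    have "[q ^ m = 1 ^ m] (mod (q - 1))"
      by (rule cong_pow) (use q1 in \<open>simp add: cong_altdef_nat\<close>)
    then have "q - 1 dvd q ^ m - 1"
      using q1 by (simp add: cong_altdef_nat)
    then show *: "N * (q - 1) = q ^ m - 1" using assms(8) by simp
    have "q ^ m > 1" using one_less_power[of q m] q1 assms(7) by simp
    then show "N > 0" using * by (cases N) auto
  qed
  \<comment> \<open>The power \<open>(\<omega> ^ N) ^ (q - 1)\<close> is 1.\<close>
  have \<omega>N: "\<omega> ^ N \<in> Fq q"
  proof -
    have "\<omega> * \<omega> ^ (q ^ m - 1) = \<omega> * 1"
      using tr.power_r_n[of \<omega>] q1 by (simp add: power_eq_if[of \<omega> "q ^ m"])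
    then have "\<omega> ^ (q ^ m - 1) = 1" using \<omega> unfolding mult_cancel_left by blast
    then have "(\<omega> ^ N) ^ (q - 1) = 1" by (simp only: N(1)[symmetric] power_mult)
    then have "(\<omega> ^ N) ^ Suc (q - 1) = \<omega> ^ N" by (simp only: power_Suc mult_1_right)
    then show ?thesis using q1 by (simp add: Fq_def)
  qed
  define I where "I = {i. i < N \<and> rtr q m (\<omega> ^ i) = 0}"
  define J where "J = {u. u < N \<and> (2 * u) mod N \<in> I}"
  define U where "U = (\<Union>t\<in>{..<N} - J. cyc \<omega> N t)"
  \<comment> \<open>Reducing \<open>2 * t\<close> modulo \<open>N\<close> splits off a power of
    \<open>\<omega> ^ N\<close>, a nonzero scalar in \<open>Fq q\<close> that passes through the
    trace.\<close>
  have J_iff: "rtr q m ((\<omega> ^ t * z) ^ 2) = 0 \<longleftrightarrow> t \<in> J" if "t < N" "z \<in> Fq q" "z \<noteq> 0" for t z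
  proof -
    have "(\<omega> ^ t) ^ 2 = (\<omega> ^ N) ^ (2 * t div N) * \<omega> ^ (2 * t mod N)"
      by (simp only: power_mult[symmetric] power_add[symmetric] mult_div_mod_eq mult.commute[of t])
    then have "(\<omega> ^ t * z) ^ 2 = ((\<omega> ^ N) ^ (2 * t div N) * z ^ 2) * \<omega> ^ (2 * t mod N)"
      by (simp add: power_mult_distrib)
    then have "rtr q m ((\<omega> ^ t * z) ^ 2) =
        ((\<omega> ^ N) ^ (2 * t div N) * z ^ 2) * rtr q m (\<omega> ^ (2 * t mod N))"
      using \<omega>N that by (simp only: T_scale K.K_intros)
    then show ?thesis using that \<omega> N by (simp add: J_def I_def)
  qed
  have U_eq: "U = {x. rtr q m (x ^ 2) \<noteq> 0}"
  proof (intro set_eqI iffI)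
    fix x assume "x \<in> U"
    then obtain t j where "t < N" "t \<notin> J" "x = \<omega> ^ t * \<omega> ^ (N * j)"
      by (auto simp: U_def cyc_def)
    then show "x \<in> {x. rtr q m (x ^ 2) \<noteq> 0}"
      using J_iff[of t "(\<omega> ^ N) ^ j"] \<omega> \<omega>N by (simp add: power_mult K.power_K)
  next
    fix x :: 'a assume x: "x \<in> {x. rtr q m (x ^ 2) \<noteq> 0}"
    then have "x \<noteq> 0" by auto
    then obtain i where "x = \<omega> ^ i" using assms(9) by blast
    then have xi: "x = \<omega> ^ (i mod N) * \<omega> ^ (N * (i div N))" by (simp flip: power_add)
    then have "i mod N \<notin> J"
      using J_iff[of "i mod N" "(\<omega> ^ N) ^ (i div N)"] x N \<omega> \<omega>N by (simp add: power_mult K.power_K)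
    then show "x \<in> U" using xi N by (auto simp: U_def cyc_def)
  qed
  define \<gamma> where "\<gamma> = \<omega> powi c"
  have "\<gamma> \<noteq> 0" using \<omega> by (simp add: \<gamma>_def)
  \<comment> \<open>As \<open>c\<close> may be negative, integer powers are used: what remains after
    reducing \<open>c\<close> modulo \<open>N\<close> is a scalar in \<open>Fq q\<close>.\<close>
  have \<gamma>_iff: "rtr q m (\<gamma> ^ 2) = 0 \<longleftrightarrow> nat (c mod int N) \<in> J"
  proof -
    have "\<gamma> = \<omega> powi (c mod int N + int N * (c div int N))" by (simp add: \<gamma>_def)
    also have "\<dots> = \<omega> powi (c mod int N) * \<omega> powi (int N * (c div int N))"
      using \<omega> by (intro power_int_add) simp
    also have "\<dots> = \<omega> powi (int (nat (c mod int N))) * (\<omega> powi int N) powi (c div int N)"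
      using N(2) by (simp add: power_int_mult)
    also have "\<dots> = \<omega> ^ nat (c mod int N) * (\<omega> ^ N) powi (c div int N)"
      by (simp only: power_int_of_nat)
    finally have eq: "\<gamma> = \<omega> ^ nat (c mod int N) * (\<omega> ^ N) powi (c div int N)" .
    have "(\<omega> ^ N) powi (c div int N) \<in> Fq q"
      using \<omega>N by (auto simp: power_int_def intro: K.K_intros)
    moreover have "nat (c mod int N) < N" using N by (simp add: nat_less_iff)
    ultimately show ?thesis unfolding eq using \<omega> by (intro J_iff) auto
  qed
  have main: "2 * psi_set ((\<lambda>x. \<gamma> * x) ` Dset q m k a b) - psi_set ((\<lambda>x. \<gamma> * x) ` U) \<in>
      (if nat (c mod int N) \<in> J then {0} else {gauss * of_nat (card (Fq q :: 'a set) ^ k),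
        - (gauss * of_nat (card (Fq q :: 'a set) ^ k))})"
    unfolding U_eq \<gamma>_iff[symmetric]
    by (rule psi_set_difference[OF refl refl psi \<open>\<gamma> \<noteq> 0\<close>])
  show ?thesis
    unfolding Let_def I_def[symmetric] J_def[symmetric] U_def[symmetric] \<gamma>_def[symmetric]
    using main gauss_pm by (auto split: if_splits)
qed

end
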